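(* As $v\to\infty$ with $v\equiv 15\pmod{18}$, there are at least $v^{v^2(1/6+o(1))}$ non-isomorphic Steiner triple systems of order $v$ that have chromatic index at least $\frac{v+3}{2}$. That is, there is a real-valued function $\varepsilon$ on the positive integers $v\equiv 15\pmod{18}$ with $\varepsilon(v)\to 0$ as $v\to\infty$ such that, for every such $v$, the number of isomorphism classes of Steiner triple systems of order $v$ with chromatic index at least $\frac{v+3}{2}$ is at least $v^{v^2(1/6+\varepsilon(v))}$.
   Context: A Steiner triple system of order $v$ is a pair $(V,\mathcal{B})$ where $V$ is a set of $v$ points and $\mathcal{B}$ is a collection of $3$-subsets of $V$ (triples) such that any two distinct points occur together in exactly one triple. Two Steiner triple systems are isomorphic if there is a bijection between their point sets mapping the triples of one exactly onto the triples of the other. A partial parallel class is a set of pairwise disjoint triples of the system. The chromatic index of $(V,\mathcal{B})$ is the smallest number of partial parallel classes into which $\mathcal{B}$ can be partitioned. *)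

theory Defs
  imports Complex_Main "HOL-Library.Disjoint_Sets" "HOL-Number_Theory.Cong"
begin

type_synonym 'a triple_system = "'a set \<times> 'a set set"

definition steiner_triple_system :: "nat \<Rightarrow> 'a triple_system \<Rightarrow> bool" where
  "steiner_triple_system v = (\<lambda>(V, B).
     finite V \<and> card V = v \<and>
     (\<forall>T\<in>B. T \<subseteq> V \<and> card T = 3) \<and>
     (\<forall>x\<in>V. \<forall>y\<in>V. x \<noteq> y \<longrightarrow> (\<exists>!T. T \<in> B \<and> x \<in> T \<and> y \<in> T)))"

definition isomorphic :: "'a triple_system \<Rightarrow> 'b triple_system \<Rightarrow> bool" where
  "isomorphic = (\<lambda>(V, B) (V', B').
     \<exists>f. bij_betw f V V' \<and> (\<lambda>T. f ` T) ` B = B')"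

definition partial_parallel_class :: "'a triple_system \<Rightarrow> 'a set set \<Rightarrow> bool" where
  "partial_parallel_class = (\<lambda>(V, B) C. C \<subseteq> B \<and> disjoint C)"

text \<open>Parts of \<^const>\<open>partition_on\<close> are nonempty, which does not affect the minimum. For finite
  systems the minimum exists, since the singletons form such a partition.\<close>

definition chromatic_index :: "'a triple_system \<Rightarrow> nat" where
  "chromatic_index = (\<lambda>(V, B).
     LEAST k. \<exists>P. partition_on B P \<and> finite P \<and> card P = k \<and>
       (\<forall>C\<in>P. partial_parallel_class (V, B) C))"

definition isomorphism_rel :: "'a triple_system set \<Rightarrow> ('a triple_system \<times> 'a triple_system) set" where
  "isomorphism_rel \<S> = {(X, Y). X \<in> \<S> \<and> Y \<in> \<S> \<and> isomorphic X Y}"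

text \<open>Every system of order \<open>v\<close>, on points of any type, is isomorphic to one with point set
  \<open>{..<v}\<close> (\<open>steiner_triple_system_representative\<close> below), and the chromatic index is invariant
  under isomorphism, so that counting isomorphism classes on \<open>{..<v}\<close> counts all of them.\<close>

definition sts_chromatic_index_ge :: "nat \<Rightarrow> real \<Rightarrow> nat triple_system set" where
  "sts_chromatic_index_ge v c =
     {S. fst S = {..<v} \<and> steiner_triple_system v S \<and> real (chromatic_index S) \<ge> c}"

definition num_sts_classes :: "nat \<Rightarrow> real \<Rightarrow> nat" where
  "num_sts_classes v c =
     card (sts_chromatic_index_ge v c // isomorphism_rel (sts_chromatic_index_ge v c))"

lemma isomorphic_refl: "isomorphic X X"
proof -
  obtain V B where X: "X = (V, B)" by fastforce
  have "bij_betw id V V \<and> (\<lambda>T. id ` T) ` B = B" by simp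
  thus ?thesis unfolding isomorphic_def X by blast
qed

lemma isomorphic_trans: "isomorphic X Y \<Longrightarrow> isomorphic Y Z \<Longrightarrow> isomorphic X Z"
  unfolding isomorphic_def
  by (force simp: image_image image_comp intro: bij_betw_trans split: prod.splits)

lemma isomorphic_sym:
  assumes "steiner_triple_system v X" "isomorphic X Y"
  shows "isomorphic Y X"
proof -
  obtain V B V' B' where XY: "X = (V, B)" "Y = (V', B')" by fastforce
  obtain f where f: "bij_betw f V V'" "(\<lambda>T. f ` T) ` B = B'"
    using assms(2) XY by (auto simp: isomorphic_def)
  let ?g = "inv_into V f"
  have "?g ` f ` T = T" if "T \<in> B" for T
  proof -
    have "T \<subseteq> V" using assms(1) XY that by (auto simp: steiner_triple_system_def)
    thus ?thesis using f(1) by (simp add: bij_betw_def inv_into_image_cancel)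
  qed
  hence "(\<lambda>T. ?g ` f ` T) ` B = (\<lambda>T. T) ` B" by (rule image_cong[OF refl])
  hence "(\<lambda>T. ?g ` T) ` (\<lambda>T. f ` T) ` B = B" by (simp only: image_image image_ident)
  hence "(\<lambda>T. ?g ` T) ` B' = B" using f(2) by simp
  moreover have "bij_betw ?g V' V" using f(1) by (rule bij_betw_inv_into)
  ultimately show ?thesis unfolding isomorphic_def XY by blast
qed

lemma equiv_isomorphism_rel:
  assumes "\<And>X. X \<in> \<S> \<Longrightarrow> steiner_triple_system v X"
  shows "equiv \<S> (isomorphism_rel \<S>)"
proof (rule equivI)
  show "refl_on \<S> (isomorphism_rel \<S>)"
    by (auto simp: refl_on_def isomorphism_rel_def isomorphic_refl)
  show "sym (isomorphism_rel \<S>)"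
    using assms isomorphic_sym by (fastforce simp: sym_def isomorphism_rel_def)
  show "trans (isomorphism_rel \<S>)"
    using isomorphic_trans by (fastforce simp: trans_def isomorphism_rel_def)
qed (auto simp: isomorphism_rel_def)

lemma finite_sts_chromatic_index_ge: "finite (sts_chromatic_index_ge v c)"
proof (rule finite_subset)
  show "sts_chromatic_index_ge v c \<subseteq> {{..<v}} \<times> Pow (Pow {..<v})"
  proof
    fix S assume S: "S \<in> sts_chromatic_index_ge v c"
    obtain V B where VB: "S = (V, B)" by fastforce
    have "V = {..<v}" "\<forall>T\<in>B. T \<subseteq> V \<and> card T = 3"
      using S unfolding VB sts_chromatic_index_ge_def steiner_triple_system_def mem_Collect_eq
        prod.case fst_conv by blast+
    thus "S \<in> {{..<v}} \<times> Pow (Pow {..<v})" unfolding VB by blast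
  qed
qed simp

lemma steiner_triple_system_representative:
  assumes "steiner_triple_system v X"
  shows "\<exists>B'. steiner_triple_system v ({..<v::nat}, B') \<and> isomorphic X ({..<v}, B')"
proof -
  obtain V B where X: "X = (V, B)" by fastforce
  have fin: "finite V" "card V = v" and tr: "\<And>T. T \<in> B \<Longrightarrow> T \<subseteq> V \<and> card T = 3"
    and pr: "\<And>x y. x \<in> V \<Longrightarrow> y \<in> V \<Longrightarrow> x \<noteq> y \<Longrightarrow> \<exists>!T. T \<in> B \<and> x \<in> T \<and> y \<in> T"
    using assms X by (auto simp: steiner_triple_system_def)
  obtain f where f: "bij_betw f V {..<v}"
    using ex_bij_betw_finite_nat[OF fin(1)] fin(2) by (auto simp: atLeast0LessThan)
  have inj: "inj_on f V" and im: "f ` V = {..<v}" using f by (auto simp: bij_betw_def)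
  let ?B = "(\<lambda>T. f ` T) ` B"
  have 1: "U \<subseteq> {..<v} \<and> card U = 3" if "U \<in> ?B" for U
    using that tr im inj by (auto simp: card_image inj_on_subset)
  have 2: "\<exists>!U. U \<in> ?B \<and> a \<in> U \<and> b \<in> U" if ab: "a < v" "b < v" "a \<noteq> b" for a b
  proof -
    obtain x y where xy: "x \<in> V" "y \<in> V" "f x = a" "f y = b"
    proof -
      have "a \<in> f ` V" "b \<in> f ` V" using im ab by simp_all
      thus ?thesis using that by blast
    qed
    have mem: "f z \<in> f ` T \<longleftrightarrow> z \<in> T" if "T \<in> B" "z \<in> V" for z T
      using inj_on_image_mem_iff[OF inj that(2)] tr[OF that(1)] by blast
    obtain T where "T \<in> B" "x \<in> T" "y \<in> T" "\<And>T'. T' \<in> B \<Longrightarrow> x \<in> T' \<Longrightarrow> y \<in> T' \<Longrightarrow> T' = T"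
    proof -
      have "x \<noteq> y" using xy(3,4) \<open>a \<noteq> b\<close> by blast
      from pr[OF xy(1,2) this] show ?thesis using that by (elim ex1E) blast
    qed
    note T = this
    show ?thesis
    proof (rule ex1I[of _ "f ` T"])
      show "f ` T \<in> ?B \<and> a \<in> f ` T \<and> b \<in> f ` T" using T xy by blast
    next
      fix U assume U: "U \<in> ?B \<and> a \<in> U \<and> b \<in> U"
      then obtain T' where T': "T' \<in> B" "U = f ` T'" by blast
      hence "x \<in> T'" "y \<in> T'" using U mem xy by blast+
      thus "U = f ` T" using T T' by blast
    qed
  qed
  have "steiner_triple_system v ({..<v}, ?B)"
    unfolding steiner_triple_system_def prod.case
  proof (intro conjI ballI impI)
    show "U \<subseteq> {..<v}" "card U = 3" if "U \<in> ?B" for U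
      using 1[OF that] by blast+
    show "\<exists>!U. U \<in> ?B \<and> a \<in> U \<and> b \<in> U" if "a \<in> {..<v}" "b \<in> {..<v}" "a \<noteq> b" for a b
      using 2[of a b] that by simp
  qed simp_all
  moreover have "isomorphic X ({..<v}, ?B)"
    using f unfolding isomorphic_def X by blast
  ultimately show ?thesis by blast
qed

end

theory Submission
  imports Defs "HOL-Combinatorics.Permutations"
begin

text \<open>
  The systems are those of Bose's construction. For odd \<open>u\<close>, take three copies (levels) of \<open>{..<u}\<close> and on
  each level \<open>i\<close> a commutative idempotent quasigroup \<open>Q i\<close>. The triples are the \<open>u\<close> vertical ones
  \<open>{(x,0), (x,1), (x,2)}\<close> and the mixed ones \<open>{(x,i), (y,i), (Q i {x,y}, i+1)}\<close>. They form a Steiner triple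
  system of order \<open>v = 3 * u\<close>, and \<open>v\<close> is congruent to \<open>15\<close> modulo \<open>18\<close> just when \<open>u\<close> is congruent to \<open>5\<close>
  modulo \<open>6\<close>.

  In that case every parallel class contains at least two vertical triples
  (\<open>parallel_class_two_verticals\<close>), by counting its points level by level modulo \<open>3\<close>. Hence there are at
  most \<open>(u - 1) / 2\<close> disjoint parallel classes, which is too few for a partition into \<open>(v + 1) / 2\<close> partial
  parallel classes (\<open>bose_chromatic_index\<close>).

  It remains to see that there are many choices. A commutative idempotent quasigroup of order \<open>u\<close> is a
  proper edge colouring of the complete graph on \<open>u\<close> vertices with \<open>u\<close> colours, normalised by naming each
  colour after the vertex at which it is missing. There are at least \<open>u\<close> to the power \<open>u\<^sup>2 * (1/2 - o(1))\<close> such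
  colourings; three independent ones give the exponent \<open>3 * u\<^sup>2 / 2 = v\<^sup>2 / 6\<close>, and neither the
  normalisation nor the passage to isomorphism classes, which costs a factor \<open>v!\<close>, changes it to leading
  order.

  The number of colourings is bounded in two stages. A complete graph on \<open>2 * m\<close> vertices consists of two
  complete graphs on \<open>m\<close> vertices and a complete bipartite graph, which leads to a recursion
  (\<open>card_complete_colourings_join\<close>, \<open>complete_colourings_lower_bound_even\<close>) whose main input is the number
  of colourings of a bipartite graph that is regular of degree \<open>m\<close> or \<open>m - 1\<close>. Such colourings come from
  splitting a \<open>2 * d\<close>-regular bipartite graph into two \<open>d\<close>-regular ones over and over again. The number of
  such splittings is nearly \<open>2\<close> to the number of edges (\<open>regular_halves_lower_bound\<close>), by the argument with
  which Schrijver bounds the number of Eulerian orientations: choose a pairing of the edges at each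
  vertex; the pairings link the edges into even cycles, and colouring these cycles alternately splits the
  graph. This elementary bound replaces the van der Waerden inequality for permanents.
\<close>

section \<open>Pairings of a finite set\<close>

text \<open>
  The predicate \<open>Q\<close> is kept as a parameter so that one recursion counts both all pairings and the
  pairings whose pairs are split by a given set.
\<close>

definition pairings :: "('a set \<Rightarrow> bool) \<Rightarrow> 'a set \<Rightarrow> 'a set set set" where
  "pairings Q X = {M. partition_on X M \<and> (\<forall>p\<in>M. card p = 2 \<and> Q p)}"

lemma pairings_empty [simp]: "pairings Q {} = {{}}"
  by (auto simp: pairings_def partition_on_def)

lemma finite_pairings: "finite X \<Longrightarrow> finite (pairings Q X)"
  unfolding pairings_def
  by (rule finite_subset[OF _ finitely_many_partition_on[of X]]) auto

lemma pairings_subset: "M \<in> pairings Q X \<Longrightarrow> p \<in> M \<Longrightarrow> p \<subseteq> X"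
  unfolding pairings_def partition_on_def mem_Collect_eq by (metis Union_upper)

lemma pairings_partner:
  assumes "M \<in> pairings Q X" "x \<in> X"
  obtains y where "y \<in> X" "y \<noteq> x" "{x, y} \<in> M" "Q {x, y}"
proof -
  obtain p where p: "p \<in> M" "x \<in> p"
    using assms by (auto simp: pairings_def partition_on_def)
  hence "card p = 2" "Q p" "p \<subseteq> X" using assms by (auto simp: pairings_def partition_on_def)
  then obtain y where "p = {x, y}" "y \<noteq> x"
    using p by (auto simp: card_2_iff)
  thus ?thesis using that p \<open>Q p\<close> \<open>p \<subseteq> X\<close> by auto
qed

lemma pairings_insert:
  assumes "x \<in> X" "y \<in> X" "x \<noteq> y" "Q {x, y}" "M \<in> pairings Q (X - {x, y})"
  shows "insert {x, y} M \<in> pairings Q X"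
proof -
  have "partition_on (X - {x, y}) M" using assms by (auto simp: pairings_def)
  moreover from this have "disjnt {x, y} (\<Union>M)" by (auto simp: partition_on_def disjnt_def)
  ultimately have "partition_on X (insert {x, y} M)"
    using assms partition_on_insert[of "{x,y}" M X] by auto
  thus ?thesis using assms by (auto simp: pairings_def)
qed

lemma pairings_remove:
  assumes "M \<in> pairings Q X" "{x, y} \<in> M"
  shows "M - {{x, y}} \<in> pairings Q (X - {x, y})"
proof -
  let ?M = "M - {{x, y}}"
  have M: "partition_on X (insert {x, y} ?M)"
    unfolding insert_Diff[OF assms(2)] using assms(1) by (simp add: pairings_def)
  have "disjnt {x, y} (\<Union>?M)"
  proof -
    have "disjoint M" using assms(1) by (simp add: pairings_def partition_on_def)
    hence "disjnt {x, y} p" if "p \<in> ?M" for p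
      using assms(2) that by (auto dest: pairwiseD[of _ _ "{x, y}" p])
    thus ?thesis by (auto simp: disjnt_def)
  qed
  hence "partition_on (X - {x, y}) ?M" using M partition_on_insert[of "{x, y}" ?M X] by simp
  thus ?thesis using assms by (auto simp: pairings_def)
qed

text \<open>
  A pairing of \<open>X\<close> is determined by the partner \<open>y\<close> of a fixed element \<open>x\<close> and a pairing of the rest.
\<close>

lemma pairings_rec:
  assumes "x \<in> X"
  shows "pairings Q X = (\<Union>y\<in>{y \<in> X - {x}. Q {x, y}}. insert {x, y} ` pairings Q (X - {x, y}))"
    (is "_ = ?R")
proof (intro equalityI subsetI)
  fix M assume M: "M \<in> pairings Q X"
  from M assms obtain y where y: "y \<in> X" "y \<noteq> x" "{x, y} \<in> M" "Q {x, y}" by (rule pairings_partner)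
  have "M = insert {x, y} (M - {{x, y}})" using y by auto
  thus "M \<in> ?R" using y pairings_remove[OF M y(3)] by blast
next
  fix M assume "M \<in> ?R"
  then obtain y N where "y \<in> X" "y \<noteq> x" "Q {x, y}" "N \<in> pairings Q (X - {x, y})"
    "M = insert {x, y} N" by blast
  thus "M \<in> pairings Q X" using assms pairings_insert[of x X y Q N] by simp
qed

lemma card_pairings_rec:
  assumes "finite X" "x \<in> X"
  shows "card (pairings Q X) = (\<Sum>y\<in>{y \<in> X - {x}. Q {x, y}}. card (pairings Q (X - {x, y})))"
proof -
  have nin: "p \<inter> {x, y} = {}" if "M \<in> pairings Q (X - {x, y})" "p \<in> M" for M p y
    using pairings_subset[OF that] by blast
  have inj: "inj_on (insert {x, y}) (pairings Q (X - {x, y}))" for y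
  proof (rule inj_onI)
    fix M N assume *: "M \<in> pairings Q (X - {x, y})" "N \<in> pairings Q (X - {x, y})"
      "insert {x, y} M = insert {x, y} N"
    have "{x, y} \<notin> M" using nin[OF *(1)] by blast
    moreover have "{x, y} \<notin> N" using nin[OF *(2)] by blast
    ultimately show "M = N" using *(3) insert_ident by metis
  qed
  have disj: "insert {x, y} ` pairings Q (X - {x, y}) \<inter> insert {x, z} ` pairings Q (X - {x, z}) = {}"
    if "y \<noteq> z" for y z
  proof (rule ccontr)
    assume "\<not> ?thesis"
    then obtain M N where *: "M \<in> pairings Q (X - {x, y})" "N \<in> pairings Q (X - {x, z})"
      "insert {x, y} M = insert {x, z} N" by blast
    have "{x, y} \<noteq> {x, z}" using that by (auto simp: doubleton_eq_iff)
    moreover have "{x, z} \<in> insert {x, y} M" unfolding *(3) by (rule insertI1)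
    ultimately have "{x, z} \<in> M" by (metis insertE)
    from nin[OF *(1) this] show False by blast
  qed
  have "card (pairings Q X)
      = (\<Sum>y\<in>{y \<in> X - {x}. Q {x, y}}. card (insert {x, y} ` pairings Q (X - {x, y})))"
    unfolding pairings_rec[OF assms(2)]
    by (rule card_UN_disjoint) (use assms(1) disj in \<open>simp_all add: finite_pairings\<close>)
  also have "\<dots> = (\<Sum>y\<in>{y \<in> X - {x}. Q {x, y}}. card (pairings Q (X - {x, y})))"
    by (intro sum.cong refl card_image inj)
  finally show ?thesis .
qed

lemma card_all_pairings:
  assumes "finite X" "card X = 2 * d"
  shows "card (pairings (\<lambda>_. True) X) = (\<Prod>i<d. 2 * i + 1)"
  using assms
proof (induction d arbitrary: X)
  case 0
  thus ?case by simp
next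
  case (Suc d)
  then obtain x where x: "x \<in> X" by fastforce
  have "card (pairings (\<lambda>_. True) (X - {x, y})) = (\<Prod>i<d. 2 * i + 1)" if "y \<in> X - {x}" for y
  proof (rule Suc.IH)
    show "card (X - {x, y}) = 2 * d" using Suc.prems x that by (subst card_Diff_subset) auto
  qed (use Suc.prems in auto)
  moreover have "card (X - {x}) = 2 * d + 1" using Suc.prems x by simp
  ultimately have "card (pairings (\<lambda>_. True) X) = (2 * d + 1) * (\<Prod>i<d. 2 * i + 1)"
    using Suc.prems x by (subst card_pairings_rec[where x = x]) (auto simp: set_diff_eq)
  thus ?case by simp
qed

lemma card_doubleton_Int:
  assumes "x \<noteq> y"
  shows "card ({x, y} \<inter> S) = 1 \<longleftrightarrow> (x \<in> S \<longleftrightarrow> y \<notin> S)"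
  using assms by (cases "x \<in> S"; cases "y \<in> S") auto

text \<open>
  The pairings that match \<open>X \<inter> S\<close> with \<open>X - S\<close> correspond to the bijections between these two sets.
\<close>

lemma card_cross_pairings:
  assumes "finite X" "card (X \<inter> S) = d" "card (X - S) = d"
  shows "card (pairings (\<lambda>p. card (p \<inter> S) = 1) X) = fact d"
  using assms
proof (induction d arbitrary: X)
  case 0
  hence "X = {}" by auto
  thus ?case by simp
next
  case (Suc d)
  then obtain x where x: "x \<in> X" "x \<in> S" by (metis IntE card.empty ex_in_conv nat.distinct(1))
  have eq: "{y \<in> X - {x}. card ({x, y} \<inter> S) = 1} = X - S"
    using x card_doubleton_Int[of x _ S] by auto
  have IH: "card (pairings (\<lambda>p. card (p \<inter> S) = 1) (X - {x, y})) = fact d" if "y \<in> X - S" for y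
  proof (rule Suc.IH)
    have "(X - {x, y}) \<inter> S = (X \<inter> S) - {x}" "(X - {x, y}) - S = (X - S) - {y}"
      using x that by auto
    thus "card ((X - {x, y}) \<inter> S) = d" "card ((X - {x, y}) - S) = d"
      using Suc.prems x that by auto
  qed (use Suc.prems in auto)
  have "card (pairings (\<lambda>p. card (p \<inter> S) = 1) X)
      = (\<Sum>y\<in>X - S. card (pairings (\<lambda>p. card (p \<inter> S) = 1) (X - {x, y})))"
    unfolding eq[symmetric] by (rule card_pairings_rec) (use Suc.prems x in auto)
  also have "\<dots> = (\<Sum>y\<in>X - S. fact d)" by (rule sum.cong[OF refl IH])
  finally show ?case using Suc.prems by simp
qed

lemma card_Int_half:
  assumes "finite X" "M \<in> pairings Q X" "\<forall>p\<in>M. card (p \<inter> S) = 1"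
  shows "card X = 2 * card (X \<inter> S)"
proof -
  have P: "partition_on X M" using assms by (auto simp: pairings_def)
  have fin: "finite M" "\<And>p. p \<in> M \<Longrightarrow> finite p"
    using assms P finite_elements by (auto simp: partition_on_def intro: finite_subset)
  have "card X = (\<Sum>p\<in>M. card p)" using product_partition[OF P] fin by simp
  also have "\<dots> = (\<Sum>p\<in>M. 2)" by (rule sum.cong) (use assms in \<open>auto simp: pairings_def\<close>)
  finally have 1: "card X = 2 * card M" by simp
  have "X \<inter> S = (\<Union>p\<in>M. p \<inter> S)" using P by (auto simp: partition_on_def)
  also have "card \<dots> = (\<Sum>p\<in>M. card (p \<inter> S))"
    by (rule card_UN_disjoint) (use fin P in \<open>auto simp: partition_on_def pairwise_def disjnt_def\<close>)
  also have "\<dots> = card M" using assms by simp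
  finally show ?thesis using 1 by simp
qed

text \<open>
  The union of two pairings of \<open>E\<close> is a graph whose components are cycles that alternate between
  \<open>M\<close> and \<open>N\<close>, hence even, so that it has a proper 2-colouring \<open>(S, E - S)\<close>. The induction removes a pair
  \<open>{e, f}\<close> of \<open>M\<close> and closes the gap in \<open>N\<close> by pairing the \<open>N\<close>-partners of \<open>e\<close> and \<open>f\<close> with each other;
  exactly one of \<open>e\<close> and \<open>f\<close> then has to be put back into the transversal.
\<close>

lemma pairings_common_transversal:
  assumes "finite E" "M \<in> pairings (\<lambda>_. True) E" "N \<in> pairings (\<lambda>_. True) E"
  shows "\<exists>S\<subseteq>E. \<forall>p\<in>M \<union> N. card (p \<inter> S) = 1"
  using assms
proof (induction "card E" arbitrary: E M N rule: less_induct)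
  case less
  show ?case
  proof (cases "E = {}")
    case True
    thus ?thesis using less.prems by auto
  next
    case False
    then obtain e where e: "e \<in> E" by blast
    from less.prems(2) e obtain f where f: "f \<in> E" "f \<noteq> e" "{e, f} \<in> M" by (rule pairings_partner)
    from less.prems(3) e obtain g where g: "g \<in> E" "g \<noteq> e" "{e, g} \<in> N" by (rule pairings_partner)
    let ?E = "E - {e, f}" and ?M = "M - {{e, f}}"
    have sm: "card ?E < card E" "finite ?E"
      by (rule psubset_card_mono) (use less.prems e f in auto)
    have M': "?M \<in> pairings (\<lambda>_. True) ?E" using less.prems(2) f(3) by (rule pairings_remove)
    have Msub: "p \<subseteq> ?E" if "p \<in> ?M" for p
      using M' that by (rule pairings_subset)
    have N1: "N - {{e, g}} \<in> pairings (\<lambda>_. True) (E - {e, g})"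
      using less.prems(3) g(3) by (rule pairings_remove)
    show ?thesis
    proof (cases "f = g")
      case True
      then obtain S where S: "S \<subseteq> ?E" "\<forall>p\<in>?M \<union> (N - {{e, g}}). card (p \<inter> S) = 1"
        using less.hyps[OF sm M'] N1 by metis
      have "card (p \<inter> insert e S) = 1" if p: "p \<in> M \<union> N" for p
      proof (cases "p = {e, f}")
        case True
        thus ?thesis using S f card_doubleton_Int[of e f "insert e S"] by auto
      next
        case False
        hence p': "p \<in> ?M \<union> (N - {{e, g}})" using p True by auto
        hence "e \<notin> p" using Msub pairings_subset[OF N1] by blast
        hence "p \<inter> insert e S = p \<inter> S" by blast
        thus ?thesis using S p' by simp
      qed
      thus ?thesis using S e by (intro exI[of _ "insert e S"]) auto
    next
      case False
      hence "f \<in> E - {e, g}" using f by auto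
      from N1 this obtain h where h: "h \<in> E - {e, g}" "h \<noteq> f" "{f, h} \<in> N - {{e, g}}"
        by (rule pairings_partner)
      let ?N = "(N - {{e, g}}) - {{f, h}}"
      have N2: "?N \<in> pairings (\<lambda>_. True) (E - {e, g} - {f, h})"
        using N1 h(3) by (rule pairings_remove)
      have Nsub: "p \<subseteq> E - {e, f, g, h}" if "p \<in> ?N" for p
        using pairings_subset[OF N2 that] by blast
      have eq: "E - {e, g} - {f, h} = ?E - {g, h}" by auto
      have N': "insert {g, h} ?N \<in> pairings (\<lambda>_. True) ?E"
        by (rule pairings_insert) (use g h False N2 eq in auto)
      obtain S where S: "S \<subseteq> ?E" "\<forall>p\<in>?M \<union> insert {g, h} ?N. card (p \<inter> S) = 1"
        using less.hyps[OF sm M' N'] by metis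
      have gh: "g \<in> S \<longleftrightarrow> h \<notin> S" using S h card_doubleton_Int[of g h S] by auto
      \<comment> \<open>If \<open>g \<in> S\<close>, then \<open>e\<close> must stay out because of \<open>{e, g}\<close>, and \<open>f\<close> must go in.\<close>
      define z where "z = (if g \<in> S then f else e)"
      have "card (p \<inter> insert z S) = 1" if p: "p \<in> M \<union> N" for p
      proof -
        consider "p = {e, f}" | "p = {e, g}" | "p = {f, h}" | "p \<in> ?M \<union> ?N" using p by auto
        thus ?thesis
        proof cases
          case 1
          thus ?thesis using f S card_doubleton_Int[of e f "insert z S"] by (auto simp: z_def)
        next
          case 2
          thus ?thesis using f g S False gh card_doubleton_Int[of e g "insert z S"]
            by (auto simp: z_def)
        next
          case 3
          thus ?thesis using f h S gh card_doubleton_Int[of f h "insert z S"]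
            by (auto simp: z_def)
        next
          case 4
          hence "z \<notin> p" using Msub Nsub unfolding z_def by (cases "g \<in> S") auto
          hence "p \<inter> insert z S = p \<inter> S" by blast
          thus ?thesis using S 4 by simp
        qed
      qed
      moreover have "z \<in> E" using e f by (auto simp: z_def)
      ultimately show ?thesis using S by (intro exI[of _ "insert z S"]) auto
    qed
  qed
qed

section \<open>Splitting a regular bipartite graph into two halves\<close>

definition regular :: "'a set \<Rightarrow> 'b set \<Rightarrow> nat \<Rightarrow> ('a \<times> 'b) set \<Rightarrow> bool" where
  "regular A B h E \<longleftrightarrow> finite A \<and> finite B \<and> E \<subseteq> A \<times> B \<and>
     (\<forall>x\<in>A. card {e \<in> E. fst e = x} = h) \<and> (\<forall>y\<in>B. card {e \<in> E. snd e = y} = h)"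

lemma regular_finite: "regular A B h E \<Longrightarrow> finite E"
  unfolding regular_def by (meson finite_SigmaI finite_subset)

lemma pairings_fibrewise:
  assumes "f \<in> (\<Pi>\<^sub>E x\<in>A. pairings (\<lambda>_. True) {e \<in> E. k e = x})" "\<forall>e\<in>E. k e \<in> A"
  shows "(\<Union>x\<in>A. f x) \<in> pairings (\<lambda>_. True) E"
proof -
  have *: "partition_on {e \<in> E. k e = x} (f x)" "\<forall>p\<in>f x. card p = 2" if "x \<in> A" for x
    using assms that by (auto simp: PiE_iff pairings_def)
  have "\<Union>(\<Union>x\<in>A. f x) = (\<Union>x\<in>A. \<Union>(f x))" by blast
  also have "\<dots> = (\<Union>x\<in>A. {e \<in> E. k e = x})"
    by (rule SUP_cong[OF refl]) (use *(1) partition_onD1 in blast)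
  also have "\<dots> = E" using assms by auto
  finally have "E = \<Union>(\<Union>x\<in>A. f x)" by simp
  moreover have "disjnt p q" if "p \<in> f x" "q \<in> f y" "p \<noteq> q" "x \<in> A" "y \<in> A" for p q x y
  proof (cases "x = y")
    case True
    thus ?thesis using *(1)[of x] that by (auto simp: partition_on_def pairwise_def)
  next
    case False
    have "p \<subseteq> {e \<in> E. k e = x}" "q \<subseteq> {e \<in> E. k e = y}"
      using *(1) that by (auto simp: partition_on_def)
    thus ?thesis using False by (auto simp: disjnt_def)
  qed
  hence "disjoint (\<Union>x\<in>A. f x)" by (auto simp: pairwise_def)
  moreover have "{} \<notin> (\<Union>x\<in>A. f x)" using *(1) by (auto simp: partition_on_def)
  ultimately have "partition_on E (\<Union>x\<in>A. f x)" unfolding partition_on_def by blast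
  thus ?thesis using *(2) by (auto simp: pairings_def)
qed

text \<open>
  Choose a pairing of the \<open>2 * d\<close> edges at each vertex, independently over the vertices. The pairings
  on the left and those on the right combine to two pairings of \<open>E\<close>, and a common transversal \<open>S\<close> of them
  meets the edges at every vertex in exactly \<open>d\<close> edges. So each of the \<open>((2d-1)!!) ^ (|A| + |B|)\<close> choices is
  accounted for by some \<open>d\<close>-regular half \<open>S\<close>; conversely a given half \<open>S\<close> is a transversal of only \<open>d!\<close>
  pairings at each vertex.
\<close>

lemma regular_halves_count:
  fixes E :: "('a \<times> 'b) set"
  assumes "regular A B (2 * d) E"
  shows "(\<Prod>i<d. 2 * i + 1) ^ (card A + card B)
    \<le> card {S. S \<subseteq> E \<and> regular A B d S} * fact d ^ (card A + card B)"
proof -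
  let ?L = "\<lambda>x. {e \<in> E. fst e = x}" and ?R = "\<lambda>y. {e \<in> E. snd e = y}"
  let ?H = "{S. S \<subseteq> E \<and> regular A B d S}"
  let ?P = "pairings (\<lambda>_. True)"
  let ?C = "\<lambda>S. pairings (\<lambda>p. card (p \<inter> S) = 1)"
  let ?all = "(\<Pi>\<^sub>E x\<in>A. ?P (?L x)) \<times> (\<Pi>\<^sub>E y\<in>B. ?P (?R y))"
  let ?cross = "\<lambda>S. (\<Pi>\<^sub>E x\<in>A. ?C S (?L x)) \<times> (\<Pi>\<^sub>E y\<in>B. ?C S (?R y))"
  have fin: "finite A" "finite B" "finite E" and sub: "E \<subseteq> A \<times> B"
    and deg: "\<And>x. x \<in> A \<Longrightarrow> card (?L x) = 2 * d" "\<And>y. y \<in> B \<Longrightarrow> card (?R y) = 2 * d"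
    using assms regular_finite[OF assms] by (auto simp: regular_def)
  have cover: "?all \<subseteq> (\<Union>S\<in>?H. ?cross S)"
  proof
    fix z assume "z \<in> ?all"
    then obtain f g where z: "z = (f, g)" and f: "f \<in> (\<Pi>\<^sub>E x\<in>A. ?P (?L x))"
      and g: "g \<in> (\<Pi>\<^sub>E y\<in>B. ?P (?R y))" by auto
    have "(\<Union>x\<in>A. f x) \<in> ?P E" by (rule pairings_fibrewise[OF f]) (use sub in auto)
    moreover have "(\<Union>y\<in>B. g y) \<in> ?P E" by (rule pairings_fibrewise[OF g]) (use sub in auto)
    ultimately obtain S where S: "S \<subseteq> E"
      "\<forall>p\<in>(\<Union>x\<in>A. f x) \<union> (\<Union>y\<in>B. g y). card (p \<inter> S) = 1"
      using pairings_common_transversal[OF fin(3)] by metis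
    have "card {e \<in> S. fst e = x} = d" if "x \<in> A" for x
    proof -
      have "card (?L x) = 2 * card (?L x \<inter> S)"
        by (rule card_Int_half[of _ "f x" "\<lambda>_. True"]) (use fin f S that in auto)
      moreover have "?L x \<inter> S = {e \<in> S. fst e = x}" using S by auto
      ultimately show ?thesis using deg that by simp
    qed
    moreover have "card {e \<in> S. snd e = y} = d" if "y \<in> B" for y
    proof -
      have "card (?R y) = 2 * card (?R y \<inter> S)"
        by (rule card_Int_half[of _ "g y" "\<lambda>_. True"]) (use fin g S that in auto)
      moreover have "?R y \<inter> S = {e \<in> S. snd e = y}" using S by auto
      ultimately show ?thesis using deg that by simp
    qed
    ultimately have "S \<in> ?H" using S(1) sub fin by (auto simp: regular_def)
    moreover have "z \<in> ?cross S" using f g S(2) by (force simp: z PiE_iff pairings_def)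
    ultimately show "z \<in> (\<Union>S\<in>?H. ?cross S)" by blast
  qed
  have cr: "card (?cross S) = fact d ^ (card A + card B)" if S: "S \<in> ?H" for S
  proof -
    have "card (?C S (?L x)) = fact d" if "x \<in> A" for x
    proof (rule card_cross_pairings)
      have "?L x \<inter> S = {e \<in> S. fst e = x}" using S by auto
      thus 1: "card (?L x \<inter> S) = d" using S that by (auto simp: regular_def)
      show "card (?L x - S) = d"
        using fin card_Int_Diff[of "?L x" S] 1 deg(1)[OF that] by simp
    qed (use fin in auto)
    moreover have "card (?C S (?R y)) = fact d" if "y \<in> B" for y
    proof (rule card_cross_pairings)
      have "?R y \<inter> S = {e \<in> S. snd e = y}" using S by auto
      thus 1: "card (?R y \<inter> S) = d" using S that by (auto simp: regular_def)
      show "card (?R y - S) = d"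
        using fin card_Int_Diff[of "?R y" S] 1 deg(2)[OF that] by simp
    qed (use fin in auto)
    ultimately show ?thesis using fin by (simp add: card_cartesian_product card_PiE power_add)
  qed
  have finH: "finite ?H" using fin by (auto intro: finite_subset[of _ "Pow E"])
  have "(\<Prod>i<d. 2 * i + 1) ^ (card A + card B) = card ?all"
    using fin deg by (simp add: card_cartesian_product card_PiE power_add card_all_pairings)
  also have "\<dots> \<le> card (\<Union>S\<in>?H. ?cross S)"
    by (rule card_mono[OF _ cover])
       (intro finite_UN_I finite_cartesian_product finite_PiE finite_pairings finH, use fin in auto)
  also have "\<dots> \<le> (\<Sum>S\<in>?H. card (?cross S))" by (rule card_UN_le[OF finH])
  also have "\<dots> = (\<Sum>S\<in>?H. fact d ^ (card A + card B))" by (rule sum.cong[OF refl cr])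
  finally show ?thesis by simp
qed

text \<open>
  This says that the central binomial coefficient \<open>2d choose d\<close>, which equals
  \<open>2 ^ d * (2d-1)!! / d!\<close>, is at least \<open>4 ^ d / (d + 1)\<close>.
\<close>

lemma odd_prod_lower_bound: "2 ^ d * fact d \<le> (d + 1) * (\<Prod>i<d. 2 * i + 1 :: nat)"
proof (induction d)
  case (Suc d)
  define p where "p = (\<Prod>i<d. 2 * i + 1 :: nat)"
  have "(d + 1) * (2 ^ Suc d * fact (Suc d)) = 2 * (d + 1) * (d + 1) * (2 ^ d * fact d)"
    by (simp add: algebra_simps)
  also have "\<dots> \<le> 2 * (d + 1) * (d + 1) * ((d + 1) * p)"
    using Suc unfolding p_def by (rule mult_left_mono) simp
  also have "\<dots> = (d + 1) * ((2 * (d + 1) * (d + 1)) * p)" by (simp only: mult_ac)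
  also have "\<dots> \<le> (d + 1) * (((d + 2) * (2 * d + 1)) * p)"
    by (rule mult_left_mono, rule mult_right_mono) (auto simp: algebra_simps)
  also have "\<dots> = (d + 1) * ((Suc d + 1) * (p * (2 * d + 1)))" by (simp add: algebra_simps)
  also have "p * (2 * d + 1) = (\<Prod>i<Suc d. 2 * i + 1)" by (simp add: p_def)
  finally show ?case by (subst (asm) mult_le_cancel1) simp
qed simp

lemma regular_halves_lower_bound:
  fixes E :: "('a \<times> 'b) set"
  assumes "regular A B (2 * d) E"
  shows "(2 ^ d) ^ (card A + card B)
    \<le> card {S. S \<subseteq> E \<and> regular A B d S} * (d + 1) ^ (card A + card B)"
proof -
  let ?N = "card A + card B" and ?h = "card {S. S \<subseteq> E \<and> regular A B d S}"
  have "(2 ^ d) ^ ?N * fact d ^ ?N = (2 ^ d * fact d :: nat) ^ ?N" by (simp add: power_mult_distrib)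
  also have "\<dots> \<le> ((d + 1) * (\<Prod>i<d. 2 * i + 1)) ^ ?N"
    by (intro power_mono odd_prod_lower_bound) simp
  also have "\<dots> = (d + 1) ^ ?N * (\<Prod>i<d. 2 * i + 1) ^ ?N" by (rule power_mult_distrib)
  also have "\<dots> \<le> (d + 1) ^ ?N * (?h * fact d ^ ?N)"
    by (intro mult_left_mono regular_halves_count assms) simp
  finally have "(2 ^ d) ^ ?N * fact d ^ ?N \<le> (?h * (d + 1) ^ ?N) * fact d ^ ?N" by (simp add: mult_ac)
  thus ?thesis by simp
qed

section \<open>Counting edge colourings of regular bipartite graphs\<close>

definition bip_colourings :: "('a \<times> 'b) set \<Rightarrow> 'c set \<Rightarrow> ('a \<times> 'b \<Rightarrow> 'c) set" where
  "bip_colourings E C = {c \<in> E \<rightarrow>\<^sub>E C.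
     \<forall>e\<in>E. \<forall>e'\<in>E. e \<noteq> e' \<longrightarrow> fst e = fst e' \<or> snd e = snd e' \<longrightarrow> c e \<noteq> c e'}"

lemma bip_colourings_neq:
  assumes "c \<in> bip_colourings E C" "e \<in> E" "e' \<in> E" "fst e = fst e' \<or> snd e = snd e'" "c e = c e'"
  shows "e = e'"
  using assms unfolding bip_colourings_def by blast

lemma finite_bip_colourings: "finite E \<Longrightarrow> finite C \<Longrightarrow> finite (bip_colourings E C)"
  unfolding bip_colourings_def
  by (rule finite_subset[of _ "E \<rightarrow>\<^sub>E C"]) (auto intro: finite_PiE)

text \<open>
  A colouring with palette \<open>C1 \<union> C2\<close> remembers the set \<open>S\<close> of edges with colours in \<open>C1\<close>, so that
  colourings obtained from different \<open>S\<close> are different.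
\<close>

lemma bip_colourings_split:
  fixes E :: "('a \<times> 'b) set"
  assumes "finite E" "finite C1" "finite C2" "C1 \<inter> C2 = {}" "H \<subseteq> Pow E"
  shows "(\<Sum>S\<in>H. card (bip_colourings S C1) * card (bip_colourings (E - S) C2))
    \<le> card (bip_colourings E (C1 \<union> C2))"
proof -
  let ?D = "SIGMA S:H. bip_colourings S C1 \<times> bip_colourings (E - S) C2"
  define glue where "glue = (\<lambda>(S, c1, c2). \<lambda>e\<in>E. if e \<in> S then c1 e else c2 e :: 'c)"
  have finH: "finite H" using assms by (meson finite_Pow_iff finite_subset)
  have fin: "finite S" if "S \<in> H" for S using that assms by (meson PowD finite_subset subsetD)
  have recover: "S = {e \<in> E. glue (S, c1, c2) e \<in> C1}"
    if "(S, c1, c2) \<in> ?D" for S c1 c2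
    using that assms by (auto simp: glue_def bip_colourings_def PiE_iff)
  have inj: "inj_on glue ?D"
  proof (rule inj_onI)
    fix z z' assume z: "z \<in> ?D" "z' \<in> ?D" "glue z = glue z'"
    obtain S c1 c2 S' c1' c2' where eq: "z = (S, c1, c2)" "z' = (S', c1', c2')"
      using prod_cases3 by metis
    have S: "S' = S" using recover[of S c1 c2] recover[of S' c1' c2'] z eq by simp
    have SE: "S \<subseteq> E" using z eq assms by auto
    have g: "glue (S, c1, c2) e = glue (S, c1', c2') e" for e using z eq S by simp
    have "c1 = c1'"
    proof (rule PiE_ext)
      show "c1 \<in> S \<rightarrow>\<^sub>E C1" "c1' \<in> S \<rightarrow>\<^sub>E C1" using z eq S by (auto simp: bip_colourings_def)
      show "c1 e = c1' e" if "e \<in> S" for e using g[of e] that SE by (auto simp: glue_def)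
    qed
    moreover have "c2 = c2'"
    proof (rule PiE_ext)
      show "c2 \<in> (E - S) \<rightarrow>\<^sub>E C2" "c2' \<in> (E - S) \<rightarrow>\<^sub>E C2"
        using z eq S by (auto simp: bip_colourings_def)
      show "c2 e = c2' e" if "e \<in> E - S" for e using g[of e] that by (auto simp: glue_def)
    qed
    ultimately show "z = z'" using eq S by simp
  qed
  have im: "glue ` ?D \<subseteq> bip_colourings E (C1 \<union> C2)"
  proof
    fix c assume "c \<in> glue ` ?D"
    then obtain S c1 c2 where *: "S \<in> H" "c1 \<in> bip_colourings S C1"
      "c2 \<in> bip_colourings (E - S) C2" "c = glue (S, c1, c2)" by auto
    have v: "c e = (if e \<in> S then c1 e else c2 e)" if "e \<in> E" for e
      using that * by (simp add: glue_def)
    have mem: "c1 e \<in> C1" if "e \<in> S" for e using that * by (auto simp: bip_colourings_def)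
    have mem2: "c2 e \<in> C2" if "e \<in> E" "e \<notin> S" for e
      using that * by (auto simp: bip_colourings_def)
    have "c \<in> E \<rightarrow>\<^sub>E C1 \<union> C2" using mem mem2 * by (auto simp: glue_def)
    moreover have "c e \<noteq> c e'"
      if "e \<in> E" "e' \<in> E" "e \<noteq> e'" "fst e = fst e' \<or> snd e = snd e'" for e e'
    proof (cases "e \<in> S \<longleftrightarrow> e' \<in> S")
      case True
      thus ?thesis using that * v by (auto simp: bip_colourings_def)
    next
      case False
      thus ?thesis using that v mem mem2 assms(4) by (auto, (metis IntI emptyE)+)
    qed
    ultimately show "c \<in> bip_colourings E (C1 \<union> C2)" by (auto simp: bip_colourings_def)
  qed
  have "finite (bip_colourings E (C1 \<union> C2))"
    using assms by (simp add: finite_bip_colourings)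
  hence "card ?D \<le> card (bip_colourings E (C1 \<union> C2))" by (rule card_inj_on_le[OF inj im])
  moreover have "card ?D = (\<Sum>S\<in>H. card (bip_colourings S C1) * card (bip_colourings (E - S) C2))"
    using finH fin assms
    by (subst card_SigmaI) (auto simp: card_cartesian_product finite_bip_colourings)
  ultimately show ?thesis by simp
qed

lemma obtain_split:
  assumes "card C = m + n"
  obtains C1 C2 where "C = C1 \<union> C2" "C1 \<inter> C2 = {}" "card C1 = m" "card C2 = n"
proof (cases "finite C")
  case True
  obtain C1 where C1: "C1 \<subseteq> C" "card C1 = m"
    using obtain_subset_with_card_n[of m C] assms by auto
  show ?thesis
  proof (rule that[of C1 "C - C1"])
    show "card (C - C1) = n" using C1 True assms by (simp add: card_Diff_subset finite_subset)
  qed (use C1 in auto)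
next
  case False
  hence "m = 0" "n = 0" using assms by auto
  thus ?thesis using that[of "{}" C] False by simp
qed

lemma regular_Diff:
  assumes "regular A B (d + k) E" "S \<subseteq> E" "regular A B d S"
  shows "regular A B k (E - S)"
proof -
  have fin: "finite E" using assms regular_finite by blast
  have "card {e \<in> E - S. P e} = card {e \<in> E. P e} - card {e \<in> S. P e}" for P
  proof -
    have "{e \<in> E - S. P e} = {e \<in> E. P e} - {e \<in> S. P e}" by auto
    moreover have "{e \<in> S. P e} \<subseteq> {e \<in> E. P e}" "finite {e \<in> S. P e}"
      using assms fin by (auto intro: finite_subset)
    ultimately show ?thesis by (simp add: card_Diff_subset)
  qed
  note * = this[of "\<lambda>e. fst e = _"] this[of "\<lambda>e. snd e = _"]
  show ?thesis using assms unfolding regular_def * by auto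
qed

text \<open>
  Halving the graph and the palette again and again, down to single matchings, yields at every level
  a factor of nearly \<open>2\<close> for each edge: of the \<open>s * 2 ^ a\<close> edges, each contributes about \<open>a\<close> bits, which is
  the optimal \<open>log 2\<close> of the degree. The term \<open>2 * a + 4\<close> is there for the induction: with it the exponent
  satisfies exactly the recursion that comes from the loss \<open>(2 ^ a + 1) ^ (2 * s) \<le> 2 ^ ((a + 1) * (2 * s))\<close>
  in each halving, and at \<open>a = 0\<close> the bound is trivial.
\<close>

lemma bip_colourings_pow2:
  fixes E :: "('a \<times> 'b) set" and C :: "'c set"
  assumes "regular A B (2 ^ a) E" "card A = s" "card B = s" "finite C" "card C = 2 ^ a"
  shows "2 ^ (s * (a * 2 ^ a + 2 * a + 4)) \<le> card (bip_colourings E C) * 2 ^ (4 * s * 2 ^ a)"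
  using assms
proof (induction a arbitrary: E C)
  case 0
  obtain k where k: "C = {k}" using 0 by (auto simp: card_1_singleton_iff)
  have one: "e = e'" if "e \<in> E" "e' \<in> E" "fst e = fst e' \<or> snd e = snd e'" for e e'
  proof -
    have sub: "E \<subseteq> A \<times> B" using 0 by (simp add: regular_def)
    from that(3) show ?thesis
    proof
      assume eq: "fst e = fst e'"
      have "card {z \<in> E. fst z = fst e} = 1" using 0 sub that(1) by (auto simp: regular_def)
      then obtain w where "{z \<in> E. fst z = fst e} = {w}" by (rule card_1_singletonE)
      hence "e \<in> {w}" "e' \<in> {w}" using eq that by auto
      thus ?thesis by simp
    next
      assume eq: "snd e = snd e'"
      have "card {z \<in> E. snd z = snd e} = 1" using 0 sub that(1) by (auto simp: regular_def)
      then obtain w where "{z \<in> E. snd z = snd e} = {w}" by (rule card_1_singletonE)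
      hence "e \<in> {w}" "e' \<in> {w}" using eq that by auto
      thus ?thesis by simp
    qed
  qed
  have "(\<lambda>e\<in>E. k) \<in> bip_colourings E C" using one by (auto simp: bip_colourings_def k)
  moreover have "finite (bip_colourings E C)"
    using 0 regular_finite by (intro finite_bip_colourings) auto
  ultimately have "card (bip_colourings E C) \<ge> 1"
    by (metis One_nat_def Suc_leI card_gt_0_iff empty_iff)
  thus ?case by (simp add: mult.commute)
next
  case (Suc a)
  let ?H = "{S. S \<subseteq> E \<and> regular A B (2 ^ a) S}"
  define X where "X = (2 :: nat) ^ (s * (a * 2 ^ a + 2 * a + 4))"
  define Y where "Y = (2 :: nat) ^ (4 * s * 2 ^ a)"
  define Z where "Z = (2 :: nat) ^ ((a + 1) * (2 * s))"
  have "card C = 2 ^ a + 2 ^ a" using Suc.prems by simp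
  then obtain C1 C2 where C: "C = C1 \<union> C2" "C1 \<inter> C2 = {}" "card C1 = 2 ^ a" "card C2 = 2 ^ a"
    by (rule obtain_split)
  have finC: "finite C1" "finite C2" using C Suc.prems by auto
  have finE: "finite E" using Suc.prems regular_finite by blast
  have each: "X * X \<le> card (bip_colourings S C1) * card (bip_colourings (E - S) C2) * (Y * Y)"
    if "S \<in> ?H" for S
  proof -
    have "regular A B (2 ^ a) (E - S)"
      by (rule regular_Diff[where d = "2 ^ a"]) (use that Suc.prems in \<open>auto simp: mult_2\<close>)
    hence "X \<le> card (bip_colourings (E - S) C2) * Y"
      unfolding X_def Y_def using Suc.IH[of "E - S" C2] Suc.prems finC C by blast
    moreover have "X \<le> card (bip_colourings S C1) * Y"
      unfolding X_def Y_def using Suc.IH[of S C1] Suc.prems finC C that by blast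
    ultimately have "X * X \<le> (card (bip_colourings S C1) * Y) * (card (bip_colourings (E - S) C2) * Y)"
      by (intro mult_le_mono)
    thus ?thesis by (simp add: mult_ac)
  qed
  have "card ?H * (X * X) = (\<Sum>S\<in>?H. X * X)" by simp
  also have "\<dots> \<le> (\<Sum>S\<in>?H. card (bip_colourings S C1) * card (bip_colourings (E - S) C2) * (Y * Y))"
    by (rule sum_mono[OF each])
  also have "\<dots> = (\<Sum>S\<in>?H. card (bip_colourings S C1) * card (bip_colourings (E - S) C2)) * (Y * Y)"
    by (simp add: sum_distrib_right)
  also have "\<dots> \<le> card (bip_colourings E C) * (Y * Y)"
    unfolding C(1) using finE finC C by (intro mult_right_mono bip_colourings_split) auto
  finally have 1: "card ?H * (X * X) \<le> card (bip_colourings E C) * (Y * Y)" .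
  have "(2 ^ 2 ^ a) ^ (card A + card B) \<le> card ?H * (2 ^ a + 1) ^ (card A + card B)"
    by (rule regular_halves_lower_bound) (use Suc.prems in simp)
  hence "(2 ^ 2 ^ a) ^ (2 * s) \<le> card ?H * (2 ^ a + 1) ^ (2 * s)"
    using Suc.prems by (simp add: mult_2)
  also have "\<dots> \<le> card ?H * (2 ^ (a + 1)) ^ (2 * s)"
    by (intro mult_left_mono power_mono) auto
  finally have 2: "2 ^ (2 ^ a * (2 * s)) \<le> card ?H * Z" unfolding Z_def power_mult .
  have "2 ^ (s * (Suc a * 2 ^ Suc a + 2 * Suc a + 4)) * Z = 2 ^ (2 ^ a * (2 * s)) * (X * X)"
    unfolding X_def Z_def power_add[symmetric] by (simp add: algebra_simps)
  also have "\<dots> \<le> card ?H * Z * (X * X)" using 2 by (rule mult_right_mono) simp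
  also have "\<dots> = card ?H * (X * X) * Z" by (simp add: mult_ac)
  also have "\<dots> \<le> card (bip_colourings E C) * (Y * Y) * Z" using 1 by (rule mult_right_mono) simp
  finally have "2 ^ (s * (Suc a * 2 ^ Suc a + 2 * Suc a + 4)) \<le> card (bip_colourings E C) * (Y * Y)"
    unfolding mult_le_cancel2 by (simp add: Z_def)
  also have "Y * Y = 2 ^ (4 * s * 2 ^ Suc a)"
    unfolding Y_def power_add[symmetric] by simp
  finally show ?case .
qed

text \<open>
  In an \<open>h\<close>-regular graph coloured with \<open>h\<close> colours every colour occurs at every vertex.
\<close>

lemma regular_palette:
  assumes "regular A B h E" "d \<in> bip_colourings E K" "card K = h" "finite K" "L \<subseteq> K"
  shows "regular A B (card L) {e \<in> E. d e \<in> L}"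
proof -
  have aux: "card {e \<in> {e \<in> E. d e \<in> L}. P e} = card L"
    if c: "card {e \<in> E. P e} = h" and inj: "inj_on d {e \<in> E. P e}" for P
  proof -
    have "finite E" using assms regular_finite by blast
    have "d ` {e \<in> E. P e} \<subseteq> K" using assms(2) by (auto simp: bip_colourings_def)
    hence im: "d ` {e \<in> E. P e} = K"
      by (rule card_subset_eq[OF assms(4)]) (simp add: card_image[OF inj] c assms(3))
    have "d ` {e \<in> {e \<in> E. d e \<in> L}. P e} = L"
    proof (intro equalityI subsetI)
      fix k assume "k \<in> L"
      hence "k \<in> d ` {e \<in> E. P e}" unfolding im using assms(5) by (rule subsetD[rotated])
      then obtain e where "e \<in> E" "P e" "d e = k" by blast
      thus "k \<in> d ` {e \<in> {e \<in> E. d e \<in> L}. P e}" using \<open>k \<in> L\<close> by blast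
    qed auto
    moreover have "inj_on d {e \<in> {e \<in> E. d e \<in> L}. P e}" by (rule inj_on_subset[OF inj]) auto
    ultimately show ?thesis using card_image by fastforce
  qed
  have inj: "inj_on d {e \<in> E. fst e = x}" "inj_on d {e \<in> E. snd e = y}" for x y
    using bip_colourings_neq[OF assms(2)] by (fastforce intro!: inj_onI)+
  show ?thesis
    unfolding regular_def
  proof (intro conjI ballI)
    show "card {e \<in> {e \<in> E. d e \<in> L}. fst e = x} = card L" if "x \<in> A" for x
      by (rule aux) (use that assms inj in \<open>auto simp: regular_def\<close>)
    show "card {e \<in> {e \<in> E. d e \<in> L}. snd e = y} = card L" if "y \<in> B" for y
      by (rule aux) (use that assms inj in \<open>auto simp: regular_def\<close>)
  qed (use assms in \<open>auto simp: regular_def\<close>)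
qed

lemma bip_colourings_restrict:
  assumes "d \<in> bip_colourings E K" "L \<subseteq> K"
  shows "restrict d {e \<in> E. d e \<in> L} \<in> bip_colourings {e \<in> E. d e \<in> L} L"
  using assms by (auto simp: bip_colourings_def)

text \<open>
  One colouring begets many. The degree \<open>h\<close> need not be a power of two, but a known colouring \<open>d\<close>
  groups the edges into \<open>q\<close> spanning subgraphs that are regular of degree \<open>2 ^ a\<close> and a remainder. Each of
  the subgraphs can be recoloured in many ways, and the remainder retains the colouring given by \<open>d\<close>.
\<close>

lemma bip_colourings_blocks:
  fixes E :: "('a \<times> 'b) set" and C :: "'c set" and K :: "'d set"
  assumes "regular A B h E" "card A = s" "card B = s" "d \<in> bip_colourings E K"
    "finite K" "card K = h" "finite C" "card C = h" "q * 2 ^ a \<le> h"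
  shows "2 ^ (s * q * 2 ^ a * a) \<le> card (bip_colourings E C) * 2 ^ (4 * (s * q * 2 ^ a))"
  using assms
proof (induction q arbitrary: h E d K C)
  case 0
  obtain f where f: "bij_betw f K C" using 0 finite_same_card_bij[of K C] by auto
  have "(\<lambda>e\<in>E. f (d e)) \<in> bip_colourings E C"
  proof -
    have d: "d e \<in> K" if "e \<in> E" for e using 0 that by (auto simp: bip_colourings_def)
    have "f (d e) \<noteq> f (d e')" if "e \<in> E" "e' \<in> E" "d e \<noteq> d e'" for e e'
      using inj_onD[OF bij_betw_imp_inj_on[OF f]] d that by blast
    moreover have "f (d e) \<in> C" if "e \<in> E" for e using bij_betwE[OF f] d that by blast
    ultimately show ?thesis using 0 unfolding bip_colourings_def by auto
  qed
  moreover have "finite (bip_colourings E C)"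
    using 0 regular_finite by (intro finite_bip_colourings) auto
  ultimately have "card (bip_colourings E C) \<ge> 1"
    by (metis One_nat_def Suc_leI card_gt_0_iff empty_iff)
  thus ?case by simp
next
  case (Suc q)
  obtain k where k: "h = 2 ^ a + k" using Suc.prems(9) le_Suc_ex[of "2 ^ a" h] by auto
  obtain K1 K2 where K: "K = K1 \<union> K2" "K1 \<inter> K2 = {}" "card K1 = 2 ^ a" "card K2 = k"
    using obtain_split[of K "2 ^ a" k] Suc.prems k by metis
  obtain C1 C2 where C: "C = C1 \<union> C2" "C1 \<inter> C2 = {}" "card C1 = 2 ^ a" "card C2 = k"
    using obtain_split[of C "2 ^ a" k] Suc.prems k by metis
  let ?E1 = "{e \<in> E. d e \<in> K1}" and ?E2 = "{e \<in> E. d e \<in> K2}"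
  have fin: "finite E" "finite K1" "finite K2" "finite C1" "finite C2"
    using Suc.prems K C regular_finite by auto
  have E2: "?E2 = E - ?E1" using K Suc.prems by (auto simp: bip_colourings_def)
  define X1 where "X1 = (2 :: nat) ^ (s * 2 ^ a * a)"
  define Y1 where "Y1 = (2 :: nat) ^ (4 * (s * 2 ^ a))"
  define X2 where "X2 = (2 :: nat) ^ (s * q * 2 ^ a * a)"
  define Y2 where "Y2 = (2 :: nat) ^ (4 * (s * q * 2 ^ a))"
  have r1: "regular A B (2 ^ a) ?E1"
    using regular_palette[OF Suc.prems(1,4,6,5), of K1] K by simp
  have r2: "regular A B k ?E2"
    using regular_palette[OF Suc.prems(1,4,6,5), of K2] K by simp
  have "X1 \<le> 2 ^ (s * (a * 2 ^ a + 2 * a + 4))"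
    unfolding X1_def by (intro power_increasing) (auto simp: algebra_simps)
  also have "\<dots> \<le> card (bip_colourings ?E1 C1) * 2 ^ (4 * s * 2 ^ a)"
    by (rule bip_colourings_pow2[OF r1]) (use Suc.prems C fin in auto)
  finally have 1: "X1 \<le> card (bip_colourings ?E1 C1) * Y1" by (simp add: Y1_def mult_ac)
  have 2: "X2 \<le> card (bip_colourings ?E2 C2) * Y2" unfolding X2_def Y2_def
  proof (rule Suc.IH[OF r2])
    show "restrict d ?E2 \<in> bip_colourings ?E2 K2"
      by (rule bip_colourings_restrict[OF Suc.prems(4)]) (use K in auto)
    show "q * 2 ^ a \<le> k" using Suc.prems(9) k by simp
  qed (use Suc.prems K C fin in auto)
  have "2 ^ (s * Suc q * 2 ^ a * a) = X1 * X2"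
    unfolding X1_def X2_def power_add[symmetric] by (simp add: algebra_simps)
  also have "\<dots> \<le> (card (bip_colourings ?E1 C1) * Y1) * (card (bip_colourings ?E2 C2) * Y2)"
    using 1 2 by (rule mult_le_mono)
  also have "\<dots> = (card (bip_colourings ?E1 C1) * card (bip_colourings (E - ?E1) C2)) * (Y1 * Y2)"
    unfolding E2 by (simp only: mult_ac)
  also have "\<dots> \<le> card (bip_colourings E C) * (Y1 * Y2)"
    using bip_colourings_split[OF fin(1,4,5) C(2), of "{?E1}"] C(1) by (intro mult_right_mono) auto
  also have "Y1 * Y2 = 2 ^ (4 * (s * Suc q * 2 ^ a))"
    unfolding Y1_def Y2_def power_add[symmetric] by (simp add: algebra_simps)
  finally show ?case .
qed

text \<open>
  For fixed large \<open>t\<close> this is nearly \<open>m\<^sup>2 * log 2 m\<close>, the binary logarithm of the number of all maps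
  from the edges of a complete bipartite graph to \<open>m\<close> colours, to leading order.
\<close>

definition bip_exponent :: "nat \<Rightarrow> nat \<Rightarrow> real" where
  "bip_exponent t m = (1 - 1 / 2 ^ t) * (real m)\<^sup>2 * log 2 (real m) - (real t + 6) * (real m)\<^sup>2"

text \<open>
  The hypothesis \<open>m \<le> h + 1\<close> covers both graphs that occur later: the complete bipartite graph, and the
  same graph with a perfect matching removed.
\<close>

lemma bip_colourings_lower_bound:
  fixes E :: "('a \<times> 'b) set" and C :: "'c set" and K :: "'d set"
  assumes "regular A B h E" "card A = m" "card B = m" "d \<in> bip_colourings E K"
    "finite K" "card K = h" "finite C" "card C = h" "m \<le> h + 1" "2 \<le> m" "1 \<le> t"
  shows "2 powr bip_exponent t m \<le> real (card (bip_colourings E C))"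
proof -
  let ?n = "card (bip_colourings E C)" and ?L = "log 2 (real m)"
  have L0: "0 \<le> ?L" using assms(10) by simp
  show ?thesis
  proof (cases "?L \<le> real t + 6")
    \<comment> \<open>For these small \<open>m\<close> the exponent is not positive, and one colouring is enough.\<close>
    case True
    have "0 \<le> 1 - 1 / (2 :: real) ^ t" "1 - 1 / (2 :: real) ^ t \<le> 1" by simp_all
    hence "(1 - 1 / 2 ^ t) * ?L \<le> 1 * (real t + 6)"
      using True L0 by (intro mult_mono) auto
    hence "((1 - 1 / 2 ^ t) * ?L - (real t + 6)) * (real m)\<^sup>2 \<le> 0"
      by (intro mult_nonpos_nonneg) auto
    hence "bip_exponent t m \<le> 0" by (simp add: bip_exponent_def algebra_simps)
    hence "2 powr bip_exponent t m \<le> 1" using powr_mono[of _ 0 "2 :: real"] by simp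
    moreover have "1 \<le> ?n" using bip_colourings_blocks[OF assms(1-8), of 0 0] by simp
    ultimately show ?thesis by linarith
  next
    case False
    obtain b where b: "2 ^ b \<le> m" "m < 2 ^ (b + 1)"
      using ex_power_ivl1[of 2 m] assms by auto
    have Lb: "?L \<le> real (b + 1)"
    proof -
      have "real m < 2 ^ (b + 1)" using b(2) by (metis of_nat_less_iff of_nat_numeral of_nat_power)
      hence "?L \<le> log 2 (2 ^ (b + 1))" using assms(10) by (subst log_le_cancel_iff) auto
      also have "\<dots> = real (b + 1)" by (simp only: log_pow_cancel)
      finally show ?thesis .
    qed
    hence "t + 4 \<le> b" using False by linarith
    \<comment> \<open>The block size \<open>2 ^ a\<close> is about \<open>m / 2 ^ t\<close>: large enough that \<open>a\<close> is nearly \<open>log 2 m\<close>, and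
      small enough that the blocks exhaust all but a \<open>2 ^ -t\<close> share of the palette.\<close>
    then obtain a where a: "b = a + t" "4 \<le> a" using that[of "b - t"] by simp
    define q where "q = h div 2 ^ a"
    have q: "q * 2 ^ a \<le> h" "h < q * 2 ^ a + 2 ^ a"
      unfolding q_def using div_times_less_eq_dividend dividend_less_div_times[of "2 ^ a" h]
      by (auto simp: add.commute)
    define X where "X = real m * (1 - 1 / 2 ^ t) - 1"
    have "real (2 ^ (a + t)) \<le> real m" using b(1) a(1) by (metis of_nat_le_iff)
    hence ma: "2 ^ a \<le> real m / 2 ^ t" by (simp add: power_add field_simps)
    have "real m - 1 \<le> real h" using assms(9) by linarith
    moreover have "real h \<le> real (q * 2 ^ a) + 2 ^ a"
      using q(2) by (metis (mono_tags, lifting) less_imp_le of_nat_add of_nat_le_iff of_nat_numeral of_nat_power)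
    ultimately have Xq: "X \<le> real (q * 2 ^ a)"
      using ma unfolding X_def by (simp add: algebra_simps)
    have t2: "1 / (2 :: real) ^ t \<le> 1 / 2"
      using power_increasing[of 1 t "2 :: real"] assms(11) by (simp add: field_simps)
    have "real m * (1 / 2) \<le> real m * (1 - 1 / 2 ^ t)" using t2 by (intro mult_left_mono) auto
    moreover have "2 \<le> real m" using assms(10) by simp
    ultimately have X0: "0 \<le> X" unfolding X_def by linarith
    have lm: "?L \<le> real m"
      using log2_of_power_le[of m m] assms(10) less_exp[of m] by simp
    have "bip_exponent t m \<le> real m * X * (?L - real t - 5)"
    proof -
      have "real m * X * (?L - real t - 5) = (1 - 1 / 2 ^ t) * (real m)\<^sup>2 * ?L
        - (real t + 5) * (1 - 1 / 2 ^ t) * (real m)\<^sup>2 - real m * ?L + real m * (real t + 5)"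
        unfolding X_def by (simp add: algebra_simps power2_eq_square)
      moreover have "real m * ?L \<le> (real m)\<^sup>2"
        using lm by (simp add: power2_eq_square mult_left_mono)
      moreover have "(real t + 5) * (1 - 1 / 2 ^ t) * (real m)\<^sup>2 \<le> (real t + 5) * 1 * (real m)\<^sup>2"
        by (intro mult_right_mono mult_left_mono) auto
      moreover have "(real t + 6) * (real m)\<^sup>2 = (real t + 5) * 1 * (real m)\<^sup>2 + (real m)\<^sup>2"
        by (simp add: algebra_simps)
      moreover have "0 \<le> real m * (real t + 5)" by simp
      ultimately show ?thesis unfolding bip_exponent_def by linarith
    qed
    also have "\<dots> \<le> real m * X * (real a - 4)"
      using Lb a(1) X0 by (intro mult_left_mono) auto
    also have "\<dots> \<le> real m * real (q * 2 ^ a) * (real a - 4)"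
      using Xq a(2) by (intro mult_right_mono mult_left_mono) auto
    also have "\<dots> = real (m * q * 2 ^ a * a) - real (4 * (m * q * 2 ^ a))"
      by (simp add: algebra_simps)
    finally have "2 powr bip_exponent t m
        \<le> 2 powr (real (m * q * 2 ^ a * a) - real (4 * (m * q * 2 ^ a)))"
      by (intro powr_mono) auto
    also have "\<dots> \<le> ?n"
    proof -
      have "(2 :: nat) ^ (m * q * 2 ^ a * a) \<le> ?n * 2 ^ (4 * (m * q * 2 ^ a))"
        by (rule bip_colourings_blocks[OF assms(1-8) q(1)])
      hence "(2 :: real) ^ (m * q * 2 ^ a * a) \<le> real ?n * 2 ^ (4 * (m * q * 2 ^ a))"
        using of_nat_mono[where 'a = real]
        by (fastforce simp only: of_nat_mult of_nat_power of_nat_numeral)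
      hence "2 powr real (m * q * 2 ^ a * a) \<le> real ?n * 2 powr real (4 * (m * q * 2 ^ a))"
        by (simp only: powr_realpow zero_less_numeral)
      thus ?thesis by (simp only: powr_diff divide_le_eq powr_gt_zero) simp
    qed
    finally show ?thesis .
  qed
qed

section \<open>Edge colourings of complete graphs\<close>

definition pairs :: "'a set \<Rightarrow> 'a set set" where
  "pairs V = {e. e \<subseteq> V \<and> card e = 2}"

lemma doubleton_in_pairs [simp]: "{x, y} \<in> pairs V \<longleftrightarrow> x \<in> V \<and> y \<in> V \<and> x \<noteq> y"
  by (auto simp: pairs_def card_insert_if)

lemma pairsE:
  assumes "e \<in> pairs V"
  obtains x y where "e = {x, y}" "x \<in> V" "y \<in> V" "x \<noteq> y"
  using assms by (auto simp: pairs_def card_2_iff)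

lemma pairs_memE:
  assumes "e \<in> pairs V" "x \<in> e"
  obtains y where "e = {x, y}" "x \<in> V" "y \<in> V" "x \<noteq> y"
proof -
  obtain a b where "e = {a, b}" "a \<in> V" "b \<in> V" "a \<noteq> b" using assms(1) by (rule pairsE)
  moreover from this have "x = a \<or> x = b" using assms(2) by simp
  ultimately show ?thesis using that[of a] that[of b] by (auto simp: insert_commute)
qed

lemma finite_pairs: "finite V \<Longrightarrow> finite (pairs V)"
  by (simp add: pairs_def)

definition complete_colourings :: "'a set \<Rightarrow> 'c set \<Rightarrow> ('a set \<Rightarrow> 'c) set" where
  "complete_colourings V C = {c \<in> pairs V \<rightarrow>\<^sub>E C.
     \<forall>x\<in>V. \<forall>y\<in>V. \<forall>z\<in>V. x \<noteq> y \<and> x \<noteq> z \<and> c {x, y} = c {x, z} \<longrightarrow> y = z}"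

lemma complete_colouringsD:
  assumes "c \<in> complete_colourings V C"
  shows "c \<in> pairs V \<rightarrow>\<^sub>E C"
    and "x \<in> V \<Longrightarrow> y \<in> V \<Longrightarrow> x \<noteq> y \<Longrightarrow> c {x, y} \<in> C"
    and "x \<in> V \<Longrightarrow> y \<in> V \<Longrightarrow> z \<in> V \<Longrightarrow> x \<noteq> y \<Longrightarrow> x \<noteq> z \<Longrightarrow> c {x, y} = c {x, z} \<Longrightarrow> y = z"
proof -
  show 1: "c \<in> pairs V \<rightarrow>\<^sub>E C" using assms by (simp add: complete_colourings_def)
  show "c {x, y} \<in> C" if "x \<in> V" "y \<in> V" "x \<noteq> y" using PiE_mem[OF 1, of "{x, y}"] that by simp
  show "y = z" if "x \<in> V" "y \<in> V" "z \<in> V" "x \<noteq> y" "x \<noteq> z" "c {x, y} = c {x, z}"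
    using assms that unfolding complete_colourings_def by blast
qed

lemma finite_complete_colourings: "finite V \<Longrightarrow> finite C \<Longrightarrow> finite (complete_colourings V C)"
  unfolding complete_colourings_def
  by (rule finite_subset[of _ "pairs V \<rightarrow>\<^sub>E C"]) (auto intro: finite_PiE finite_pairs)

text \<open>
  This is used only when the palette has as many colours as there are vertices, in which case every
  vertex misses exactly one colour.
\<close>

definition missing_colour :: "'a set \<Rightarrow> 'c set \<Rightarrow> ('a set \<Rightarrow> 'c) \<Rightarrow> 'a \<Rightarrow> 'c" where
  "missing_colour V C c x = (THE k. k \<in> C \<and> (\<forall>y\<in>V - {x}. c {x, y} \<noteq> k))"

context
  fixes V :: "'a set" and C :: "'c set" and c :: "'a set \<Rightarrow> 'c"
  assumes fin: "finite V" "finite C" and card_eq: "card C = card V"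
    and c: "c \<in> complete_colourings V C"
begin

lemma missing_colour_ex1:
  assumes "x \<in> V"
  shows "\<exists>!k. k \<in> C \<and> (\<forall>y\<in>V - {x}. c {x, y} \<noteq> k)"
proof -
  let ?I = "(\<lambda>y. c {x, y}) ` (V - {x})"
  have "inj_on (\<lambda>y. c {x, y}) (V - {x})"
    using complete_colouringsD(3)[OF c assms] by (auto intro!: inj_onI)
  hence "card ?I = card V - 1" using fin assms by (simp add: card_image)
  moreover have "?I \<subseteq> C" using complete_colouringsD(2)[OF c assms] by auto
  moreover have "card V \<ge> 1" using assms fin by (metis One_nat_def Suc_leI card_gt_0_iff empty_iff)
  ultimately have "card (C - ?I) = 1" using fin card_eq by (subst card_Diff_subset) auto
  then obtain k where "C - ?I = {k}" by (rule card_1_singletonE)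
  thus ?thesis by (intro ex1I[of _ k]) auto
qed

lemma missing_colour_mem: "x \<in> V \<Longrightarrow> missing_colour V C c x \<in> C"
  and missing_colour_neq:
    "x \<in> V \<Longrightarrow> y \<in> V \<Longrightarrow> x \<noteq> y \<Longrightarrow> c {x, y} \<noteq> missing_colour V C c x"
  using theI'[OF missing_colour_ex1] unfolding missing_colour_def by auto

lemma missing_colour_eqI:
  assumes "x \<in> V" "k \<in> C" "\<And>y. y \<in> V \<Longrightarrow> y \<noteq> x \<Longrightarrow> c {x, y} \<noteq> k"
  shows "missing_colour V C c x = k"
  unfolding missing_colour_def
  by (rule the1_equality[OF missing_colour_ex1[OF assms(1)]]) (use assms in auto)

lemma colour_present:
  assumes "x \<in> V" "k \<in> C" "k \<noteq> missing_colour V C c x"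
  obtains y where "y \<in> V" "y \<noteq> x" "c {x, y} = k"
  using missing_colour_eqI[OF assms(1,2)] assms(3) by metis

text \<open>
  A colour class is a set of disjoint pairs, so on an odd number of vertices it cannot cover all of
  them: every colour is missing somewhere. By counting, it is missing at just one vertex.
\<close>

lemma missing_colour_bij:
  assumes "odd (card V)"
  shows "bij_betw (missing_colour V C c) V C"
proof -
  have "k \<in> missing_colour V C c ` V" if k: "k \<in> C" for k
  proof (rule ccontr)
    assume "k \<notin> missing_colour V C c ` V"
    hence ex: "\<exists>y\<in>V. y \<noteq> x \<and> c {x, y} = k" if "x \<in> V" for x
      using colour_present[OF that k] that by blast
    let ?M = "{e \<in> pairs V. c e = k}"
    have "partition_on V ?M"
    proof (rule partition_onI)
      show "\<Union>?M = V"
      proof (intro equalityI subsetI)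
        fix x assume "x \<in> V"
        then obtain y where "y \<in> V" "y \<noteq> x" "c {x, y} = k" using ex by blast
        hence "{x, y} \<in> ?M" using \<open>x \<in> V\<close> by simp
        thus "x \<in> \<Union>?M" by blast
      qed (auto simp: pairs_def)
      show "disjnt e e'" if e: "e \<in> ?M" "e' \<in> ?M" "e \<noteq> e'" for e e'
      proof (rule ccontr)
        assume "\<not> disjnt e e'"
        then obtain x where x: "x \<in> e" "x \<in> e'" by (auto simp: disjnt_def)
        have p: "e \<in> pairs V" "e' \<in> pairs V" "c e = c e'" using e by simp_all
        obtain y where y: "e = {x, y}" "x \<in> V" "y \<in> V" "x \<noteq> y" using p(1) x(1) by (rule pairs_memE)
        obtain z where z: "e' = {x, z}" "x \<in> V" "z \<in> V" "x \<noteq> z" using p(2) x(2) by (rule pairs_memE)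
        have "y = z" using complete_colouringsD(3)[OF c, of x y z] y z p(3) by simp
        thus False using e(3) y z by simp
      qed
      show "{} \<notin> ?M" by (simp add: pairs_def)
    qed
    hence "card V = (\<Sum>e\<in>?M. card e)"
      by (rule product_partition) (use fin in \<open>auto simp: pairs_def intro: finite_subset\<close>)
    also have "\<dots> = (\<Sum>e\<in>?M. 2)" by (rule sum.cong) (auto simp: pairs_def)
    finally show False using assms by simp
  qed
  hence "missing_colour V C c ` V = C" using missing_colour_mem by blast
  moreover from this have "inj_on (missing_colour V C c) V"
    using fin card_eq by (simp add: eq_card_imp_inj_on)
  ultimately show ?thesis by (simp add: bij_betw_def)
qed

end

text \<open>
  Deleting a vertex \<open>z\<close> loses no information: the colour of \<open>{x, z}\<close> can be read off as the colour
  that has become missing at \<open>x\<close>.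
\<close>

lemma card_complete_colourings_delete_vertex:
  assumes "finite V" "finite C" "card C = card V" "z \<notin> V"
  shows "card (complete_colourings (insert z V) C) \<le> card (complete_colourings V C)"
proof (rule card_inj_on_le)
  let ?r = "\<lambda>c. restrict c (pairs V)"
  have sub: "pairs V \<subseteq> pairs (insert z V)" by (auto simp: pairs_def)
  have r: "?r c \<in> complete_colourings V C" if "c \<in> complete_colourings (insert z V) C" for c
  proof -
    note D = complete_colouringsD[OF that]
    have "?r c \<in> pairs V \<rightarrow>\<^sub>E C" using D(1) sub by auto
    thus ?thesis using D(3) by (auto simp: complete_colourings_def)
  qed
  thus "?r ` complete_colourings (insert z V) C \<subseteq> complete_colourings V C" by blast
  have z: "c {x, z} = missing_colour V C (?r c) x"
    if c: "c \<in> complete_colourings (insert z V) C" and x: "x \<in> V" for c x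
  proof -
    have xz: "x \<noteq> z" using x assms by auto
    show ?thesis
    proof (rule missing_colour_eqI[OF assms(1-3) r[OF c] x, symmetric])
      show "c {x, z} \<in> C" using complete_colouringsD(2)[OF c] x xz by simp
      show "?r c {x, y} \<noteq> c {x, z}" if "y \<in> V" "y \<noteq> x" for y
        using complete_colouringsD(3)[OF c, of x y z] that x xz assms(4) by auto
    qed
  qed
  show "inj_on ?r (complete_colourings (insert z V) C)"
  proof (rule inj_onI)
    fix c c' assume c: "c \<in> complete_colourings (insert z V) C"
      "c' \<in> complete_colourings (insert z V) C" and eq: "?r c = ?r c'"
    show "c = c'"
    proof (rule PiE_ext[OF complete_colouringsD(1)[OF c(1)] complete_colouringsD(1)[OF c(2)]])
      fix e assume e: "e \<in> pairs (insert z V)"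
      show "c e = c' e"
      proof (cases "e \<in> pairs V")
        case True
        thus ?thesis using fun_cong[OF eq, of e] by simp
      next
        case False
        hence "z \<in> e" using e by (auto simp: pairs_def)
        with e obtain x where "e = {z, x}" "x \<in> insert z V" "z \<noteq> x" by (rule pairs_memE)
        hence "x \<in> V" "e = {x, z}" by (auto simp: insert_commute)
        thus ?thesis using z c eq by metis
      qed
    qed
  qed
qed (use assms in \<open>simp add: finite_complete_colourings\<close>)

text \<open>
  Colourings of the edges between \<open>A\<close> and \<open>B\<close> that extend the colourings \<open>f\<close> and \<open>g\<close> of the complete
  graphs on \<open>A\<close> and \<open>B\<close>, both with palette \<open>C1\<close>, to the complete graph on \<open>A \<union> B\<close>.
\<close>

definition join_compatible ::
  "'a set \<Rightarrow> 'a set \<Rightarrow> 'c set \<Rightarrow> 'c set \<Rightarrow> ('a set \<Rightarrow> 'c) \<Rightarrow> ('a set \<Rightarrow> 'c) \<Rightarrow> ('a \<times> 'a \<Rightarrow> 'c) set" where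
  "join_compatible A B C1 C2 f g = {l \<in> bip_colourings (A \<times> B) (C1 \<union> C2).
     \<forall>x\<in>A. \<forall>y\<in>B. l (x, y) \<in> C1 \<longrightarrow>
       (\<forall>x'\<in>A - {x}. f {x, x'} \<noteq> l (x, y)) \<and> (\<forall>y'\<in>B - {y}. g {y, y'} \<noteq> l (x, y))}"

text \<open>
  The colouring of the whole graph determines its three parts, and compatibility is just what makes
  the parts fit together.
\<close>

lemma card_complete_colourings_join:
  fixes C1 C2 :: "'c set"
  assumes AB: "A \<inter> B = {}" "finite A" "finite B"
    and C: "C1 \<inter> C2 = {}" "finite C1" "finite C2"
    and N: "\<And>f g. f \<in> complete_colourings A C1 \<Longrightarrow> g \<in> complete_colourings B C1 \<Longrightarrow>
      N \<le> card (join_compatible A B C1 C2 f g)"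
  shows "card (complete_colourings A C1) * card (complete_colourings B C1) * N
    \<le> card (complete_colourings (A \<union> B) (C1 \<union> C2))"
proof -
  let ?P = "complete_colourings A C1 \<times> complete_colourings B C1"
  let ?D = "SIGMA p:?P. join_compatible A B C1 C2 (fst p) (snd p)"
  define glue :: "_ \<Rightarrow> 'a set \<Rightarrow> 'c" where
    "glue = (\<lambda>((f, g), l). \<lambda>e\<in>pairs (A \<union> B). if e \<subseteq> A then f e else if e \<subseteq> B then g e
       else l (the_elem (e \<inter> A), the_elem (e \<inter> B)))"
  have gA: "glue ((f, g), l) {x, x'} = f {x, x'}" if "x \<in> A" "x' \<in> A" "x \<noteq> x'" for f g l x x'
    using that by (simp add: glue_def)
  have gB: "glue ((f, g), l) {y, y'} = g {y, y'}" if "y \<in> B" "y' \<in> B" "y \<noteq> y'" for f g l y y'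
    using that AB by (auto simp: glue_def)
  have gX: "glue ((f, g), l) {x, y} = l (x, y)" "glue ((f, g), l) {y, x} = l (x, y)"
    if "x \<in> A" "y \<in> B" for f g l x y
  proof -
    have *: "x \<noteq> y" "x \<notin> B" "y \<notin> A" using that AB by auto
    hence "{x, y} \<inter> A = {x}" "{x, y} \<inter> B = {y}" using that by auto
    thus "glue ((f, g), l) {x, y} = l (x, y)" using that * by (simp add: glue_def)
    thus "glue ((f, g), l) {y, x} = l (x, y)" by (simp add: insert_commute)
  qed
  have bip: "l \<in> bip_colourings (A \<times> B) (C1 \<union> C2)" if "l \<in> join_compatible A B C1 C2 f g" for f g l
    using that by (simp add: join_compatible_def)
  have inj: "inj_on glue ?D"
  proof (rule inj_onI)
    fix p p' assume p: "p \<in> ?D" "p' \<in> ?D" "glue p = glue p'"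
    obtain f g l f' g' l' where eq: "p = ((f, g), l)" "p' = ((f', g'), l')"
      by (metis surj_pair)
    have same: "glue ((f, g), l) e = glue ((f', g'), l') e" for e using p eq by simp
    have f: "f \<in> complete_colourings A C1" "f' \<in> complete_colourings A C1"
      and g: "g \<in> complete_colourings B C1" "g' \<in> complete_colourings B C1"
      and l: "l \<in> bip_colourings (A \<times> B) (C1 \<union> C2)" "l' \<in> bip_colourings (A \<times> B) (C1 \<union> C2)"
      using p eq bip by auto
    have "f = f'"
    proof (rule PiE_ext[OF complete_colouringsD(1)[OF f(1)] complete_colouringsD(1)[OF f(2)]])
      show "f e = f' e" if "e \<in> pairs A" for e
        using that same by (elim pairsE) (metis gA)
    qed
    moreover have "g = g'"
    proof (rule PiE_ext[OF complete_colouringsD(1)[OF g(1)] complete_colouringsD(1)[OF g(2)]])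
      show "g e = g' e" if "e \<in> pairs B" for e
        using that same by (elim pairsE) (metis gB)
    qed
    moreover have "l = l'"
    proof (rule PiE_ext)
      show "l \<in> A \<times> B \<rightarrow>\<^sub>E C1 \<union> C2" "l' \<in> A \<times> B \<rightarrow>\<^sub>E C1 \<union> C2"
        using l by (auto simp: bip_colourings_def)
      show "l e = l' e" if "e \<in> A \<times> B" for e
        using that same by (elim SigmaE) (metis gX(1))
    qed
    ultimately show "p = p'" using eq by simp
  qed
  have im: "glue ` ?D \<subseteq> complete_colourings (A \<union> B) (C1 \<union> C2)"
  proof
    fix c assume "c \<in> glue ` ?D"
    then obtain f g l where c: "c = glue ((f, g), l)" and f: "f \<in> complete_colourings A C1"
      and g: "g \<in> complete_colourings B C1" and l: "l \<in> join_compatible A B C1 C2 f g"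
      by auto
    note lb = bip[OF l]
    have lC: "l (x, y) \<in> C1 \<union> C2" if "x \<in> A" "y \<in> B" for x y
      using lb that unfolding bip_colourings_def by blast
    have cA: "c {x, x'} = f {x, x'}" if "x \<in> A" "x' \<in> A" "x \<noteq> x'" for x x'
      unfolding c by (rule gA[OF that])
    have cB: "c {y, y'} = g {y, y'}" if "y \<in> B" "y' \<in> B" "y \<noteq> y'" for y y'
      unfolding c by (rule gB[OF that])
    have cX: "c {x, y} = l (x, y)" "c {y, x} = l (x, y)" if "x \<in> A" "y \<in> B" for x y
      unfolding c by (rule gX[OF that])+
    have mA: "l (x, y) \<noteq> f {x, x'}" if "x \<in> A" "x' \<in> A" "x \<noteq> x'" "y \<in> B" for x x' y
    proof
      assume e: "l (x, y) = f {x, x'}"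
      hence "l (x, y) \<in> C1" using complete_colouringsD(2)[OF f] that by simp
      thus False using l that e unfolding join_compatible_def by force
    qed
    have mB: "l (x, y) \<noteq> g {y, y'}" if "y \<in> B" "y' \<in> B" "y \<noteq> y'" "x \<in> A" for x y y'
    proof
      assume e: "l (x, y) = g {y, y'}"
      hence "l (x, y) \<in> C1" using complete_colouringsD(2)[OF g] that by simp
      thus False using l that e unfolding join_compatible_def by force
    qed
    have "c \<in> pairs (A \<union> B) \<rightarrow>\<^sub>E C1 \<union> C2"
    proof (rule PiE_I)
      fix e assume "e \<in> pairs (A \<union> B)"
      then obtain x y where e: "e = {x, y}" "x \<in> A \<union> B" "y \<in> A \<union> B" "x \<noteq> y" by (rule pairsE)
      show "c e \<in> C1 \<union> C2"
      proof (cases "x \<in> A")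
        case True
        show ?thesis
        proof (cases "y \<in> A")
          case y: True
          show ?thesis using cA[OF True y] e complete_colouringsD(2)[OF f True y] by simp
        next
          case False
          hence "y \<in> B" using e by simp
          thus ?thesis using cX(1)[OF True] lC[OF True] e by simp
        qed
      next
        case False
        hence x: "x \<in> B" using e by simp
        show ?thesis
        proof (cases "y \<in> A")
          case True
          thus ?thesis using cX(2)[OF True x] lC[OF True x] e by simp
        next
          case False
          hence y: "y \<in> B" using e by simp
          show ?thesis using cB[OF x y] e complete_colouringsD(2)[OF g x y] by simp
        qed
      qed
    qed (simp add: c glue_def)
    moreover have "y = z" if h: "x \<in> A \<union> B" "y \<in> A \<union> B" "z \<in> A \<union> B" "x \<noteq> y" "x \<noteq> z" "c {x, y} = c {x, z}"
      for x y z
    proof (cases "x \<in> A")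
      case True
      consider "y \<in> A" "z \<in> A" | "y \<in> A" "z \<in> B" | "y \<in> B" "z \<in> A" | "y \<in> B" "z \<in> B"
        using h by blast
      thus ?thesis
      proof cases
        case 1 thus ?thesis using complete_colouringsD(3)[OF f, of x y z] cA True h by simp
      next
        case 2 thus ?thesis using mA[of x y z] cA cX True h by simp
      next
        case 3 thus ?thesis using mA[of x z y] cA cX True h by simp
      next
        case 4
        hence "l (x, y) = l (x, z)" using cX True h by simp
        thus ?thesis using bip_colourings_neq[OF lb, of "(x, y)" "(x, z)"] True 4 by simp
      qed
    next
      case False
      hence x: "x \<in> B" using h by simp
      consider "y \<in> A" "z \<in> A" | "y \<in> A" "z \<in> B" | "y \<in> B" "z \<in> A" | "y \<in> B" "z \<in> B"
        using h by blast
      thus ?thesis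
      proof cases
        case 4 thus ?thesis using complete_colouringsD(3)[OF g, of x y z] cB x h by simp
      next
        case 2 thus ?thesis using mB[of x z y] cB cX x h by simp
      next
        case 3 thus ?thesis using mB[of x y z] cB cX x h by simp
      next
        case 1
        hence "l (y, x) = l (z, x)" using cX x h by simp
        thus ?thesis using bip_colourings_neq[OF lb, of "(y, x)" "(z, x)"] x 1 by simp
      qed
    qed
    ultimately show "c \<in> complete_colourings (A \<union> B) (C1 \<union> C2)"
      unfolding complete_colourings_def by blast
  qed
  have finJ: "finite (join_compatible A B C1 C2 f g)" for f g
    by (rule finite_subset[of _ "bip_colourings (A \<times> B) (C1 \<union> C2)"])
       (use AB C in \<open>auto simp: join_compatible_def finite_bip_colourings\<close>)
  have finP: "finite ?P" using AB C by (simp add: finite_complete_colourings)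
  have "card ?P * N = (\<Sum>p\<in>?P. N)" by simp
  also have "\<dots> \<le> (\<Sum>p\<in>?P. card (join_compatible A B C1 C2 (fst p) (snd p)))"
    by (rule sum_mono) (use N in auto)
  also have "\<dots> = card ?D" using finP finJ by simp
  also have "\<dots> \<le> card (complete_colourings (A \<union> B) (C1 \<union> C2))"
    by (rule card_inj_on_le[OF inj im]) (use AB C in \<open>simp add: finite_complete_colourings\<close>)
  finally show ?thesis by (simp add: card_cartesian_product)
qed

text \<open>
  This is the addition table of the integers modulo \<open>m\<close>, transported along \<open>p\<close> and \<open>q\<close>. The second part
  identifies the colour class of \<open>0\<close>, so that any prescribed perfect matching can be made this class.
\<close>

lemma cyclic_colouring:
  fixes m :: nat
  assumes "bij_betw p A {..<m}" "bij_betw q B {..<m}"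
  shows "(\<lambda>e\<in>A \<times> B. (q (snd e) + (m - p (fst e))) mod m) \<in> bip_colourings (A \<times> B) {..<m}"
    (is "?d \<in> _")
    and "x \<in> A \<Longrightarrow> y \<in> B \<Longrightarrow> (q y + (m - p x)) mod m = 0 \<longleftrightarrow> p x = q y"
proof -
  have lt: "p x < m" if "x \<in> A" for x using bij_betwE[OF assms(1)] that by simp
  have lt': "q y < m" if "y \<in> B" for y using bij_betwE[OF assms(2)] that by simp
  have v: "(q y + (m - p x)) mod m = (if p x \<le> q y then q y - p x else q y + m - p x)"
    if "x \<in> A" "y \<in> B" for x y
  proof (cases "p x \<le> q y")
    case True
    hence "q y + (m - p x) = (q y - p x) + m" using lt[OF that(1)] by simp
    moreover have "(q y - p x) mod m = q y - p x" using lt'[OF that(2)] by simp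
    ultimately show ?thesis using True by (metis mod_add_self2)
  next
    case False
    hence "q y + (m - p x) < m" using lt[OF that(1)] by linarith
    thus ?thesis using False lt[OF that(1)] by simp
  qed
  show "(q y + (m - p x)) mod m = 0 \<longleftrightarrow> p x = q y" if "x \<in> A" "y \<in> B" for x y
    unfolding v[OF that] using lt[OF that(1)] by auto
  have ip: "x = x'" if "x \<in> A" "x' \<in> A" "p x = p x'" for x x'
    using inj_onD[OF bij_betw_imp_inj_on[OF assms(1)] that(3)] that by blast
  have iq: "y = y'" if "y \<in> B" "y' \<in> B" "q y = q y'" for y y'
    using inj_onD[OF bij_betw_imp_inj_on[OF assms(2)] that(3)] that by blast
  have "?d \<in> A \<times> B \<rightarrow>\<^sub>E {..<m}" by (auto intro!: mod_less_divisor dest!: lt)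
  moreover have "e = e'"
    if h: "e \<in> A \<times> B" "e' \<in> A \<times> B" "fst e = fst e' \<or> snd e = snd e'" "?d e = ?d e'" for e e'
  proof -
    obtain x y x' y' where e: "e = (x, y)" "e' = (x', y')" "x \<in> A" "x' \<in> A" "y \<in> B" "y' \<in> B"
      using h by auto
    have d: "(if p x \<le> q y then q y - p x else q y + m - p x)
        = (if p x' \<le> q y' then q y' - p x' else q y' + m - p x')"
      using h e by (simp add: v)
    show ?thesis
    proof (cases "x = x'")
      case True
      have "q y = q y'" using d lt[of x'] lt'[of y] lt'[of y'] e unfolding True by (auto split: if_splits)
      thus ?thesis using iq e True by simp
    next
      case False
      hence y: "y = y'" using h e by simp
      have "p x = p x'" using d lt[of x] lt[of x'] lt'[of y'] e unfolding y by (auto split: if_splits)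
      thus ?thesis using ip e y by simp
    qed
  qed
  ultimately show "?d \<in> bip_colourings (A \<times> B) {..<m}" unfolding bip_colourings_def by blast
qed

lemma regular_complete_bipartite:
  assumes "finite A" "finite B" "card A = m" "card B = m"
  shows "regular A B m (A \<times> B)"
proof -
  have "{e \<in> A \<times> B. fst e = x} = {x} \<times> B" if "x \<in> A" for x using that by auto
  moreover have "{e \<in> A \<times> B. snd e = y} = A \<times> {y}" if "y \<in> B" for y using that by auto
  ultimately show ?thesis using assms by (simp add: regular_def card_cartesian_product)
qed

text \<open>
  Here the edges between \<open>A\<close> and \<open>B\<close> use only the new colours \<open>C2\<close>.
\<close>

lemma join_compatible_even:
  assumes "finite A" "finite B" "card A = m" "card B = m" "C1 \<inter> C2 = {}"
    "finite C2" "card C2 = m" "2 \<le> m" "1 \<le> t" "finite C1"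
  shows "2 powr bip_exponent t m \<le> card (join_compatible A B C1 C2 f g)"
proof -
  obtain p q where pq: "bij_betw p A {..<m}" "bij_betw q B {..<m}"
    using finite_same_card_bij[of A "{..<m}"] finite_same_card_bij[of B "{..<m}"] assms by auto
  have "2 powr bip_exponent t m \<le> card (bip_colourings (A \<times> B) C2)"
    by (rule bip_colourings_lower_bound[OF regular_complete_bipartite[OF assms(1-4)] assms(3,4)
          cyclic_colouring(1)[OF pq]]) (use assms in auto)
  also have "card (bip_colourings (A \<times> B) C2) \<le> card (join_compatible A B C1 C2 f g)"
  proof (rule card_mono)
    show "finite (join_compatible A B C1 C2 f g)"
      by (rule finite_subset[of _ "bip_colourings (A \<times> B) (C1 \<union> C2)"])
         (use assms in \<open>auto simp: join_compatible_def finite_bip_colourings\<close>)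
    have "l (x, y) \<in> C2" if "l \<in> bip_colourings (A \<times> B) C2" "x \<in> A" "y \<in> B" for l x y
      using that unfolding bip_colourings_def by blast
    moreover have "bip_colourings (A \<times> B) C2 \<subseteq> bip_colourings (A \<times> B) (C1 \<union> C2)"
      unfolding bip_colourings_def by blast
    ultimately show "bip_colourings (A \<times> B) C2 \<subseteq> join_compatible A B C1 C2 f g"
      unfolding join_compatible_def using assms(5) by blast
  qed
  finally show ?thesis by simp
qed

text \<open>
  For odd \<open>m\<close> the complete graphs on \<open>A\<close> and \<open>B\<close> need \<open>m\<close> colours each, and every vertex misses one of
  them. Joining \<open>x \<in> A\<close> to the \<open>y \<in> B\<close> that misses the same colour, and using this colour for the edge,
  removes a perfect matching from the bipartite graph; the remaining edges take the \<open>m - 1\<close> new colours.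
\<close>

lemma join_compatible_odd:
  fixes C1 C2 :: "'c set"
  assumes fin: "finite A" "finite B" "finite C1" "finite C2"
    and card: "card A = m" "card B = m" "card C1 = m" "card C2 = m - 1"
    and C: "C1 \<inter> C2 = {}" and m: "2 \<le> m" "odd m" and t: "1 \<le> t"
    and f: "f \<in> complete_colourings A C1" and g: "g \<in> complete_colourings B C1"
  shows "2 powr bip_exponent t m \<le> card (join_compatible A B C1 C2 f g)"
proof -
  let ?mf = "missing_colour A C1 f" and ?mg = "missing_colour B C1 g"
  have bf: "bij_betw ?mf A C1" and bg: "bij_betw ?mg B C1"
    using missing_colour_bij fin card m f g by metis+
  obtain r where r: "bij_betw r C1 {..<m}" using finite_same_card_bij[of C1 "{..<m}"] fin card by auto
  let ?p = "r \<circ> ?mf" and ?q = "r \<circ> ?mg"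
  have pq: "bij_betw ?p A {..<m}" "bij_betw ?q B {..<m}"
    using bf bg r by (auto intro: bij_betw_trans)
  define d where "d = (\<lambda>e\<in>A \<times> B. (?q (snd e) + (m - ?p (fst e))) mod m)"
  let ?E = "{e \<in> A \<times> B. d e \<in> {1..<m}}"
  have d: "d \<in> bip_colourings (A \<times> B) {..<m}" unfolding d_def by (rule cyclic_colouring(1)[OF pq])
  have reg: "regular A B (m - 1) ?E"
    using regular_palette[OF regular_complete_bipartite[OF fin(1,2) card(1,2)] d, of "{1..<m}"]
    by (simp del: mem_Sigma_iff) (simp add: subset_eq)
  have dE: "restrict d ?E \<in> bip_colourings ?E {1..<m}"
    by (rule bip_colourings_restrict[OF d]) auto
  have inE: "(x, y) \<in> ?E \<longleftrightarrow> ?mf x \<noteq> ?mg y" if "x \<in> A" "y \<in> B" for x y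
  proof -
    have pq_iff: "?p x = ?q y \<longleftrightarrow> ?mf x = ?mg y"
      using inj_on_eq_iff[OF bij_betw_imp_inj_on[OF r]] bij_betwE[OF bf] bij_betwE[OF bg] that by simp
    have v: "d (x, y) = (?q y + (m - ?p x)) mod m" using that by (simp add: d_def)
    hence "d (x, y) < m" using m by simp
    hence "(x, y) \<in> ?E \<longleftrightarrow> d (x, y) \<noteq> 0" using that by auto
    also have "\<dots> \<longleftrightarrow> ?p x \<noteq> ?q y" unfolding v cyclic_colouring(2)[OF pq that] by (rule refl)
    finally show ?thesis unfolding pq_iff .
  qed
  define ext where "ext = (\<lambda>l. \<lambda>e\<in>A \<times> B. if e \<in> ?E then l e else ?mf (fst e))"
  have ext_apply: "ext l (x, y) = (if (x, y) \<in> ?E then l (x, y) else ?mf x)" if "x \<in> A" "y \<in> B" for l x y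
    using that unfolding ext_def by simp
  have "2 powr bip_exponent t m \<le> card (bip_colourings ?E C2)"
    by (rule bip_colourings_lower_bound[OF reg card(1,2) dE]) (use fin card m t in auto)
  also have "card (bip_colourings ?E C2) \<le> card (join_compatible A B C1 C2 f g)"
  proof (rule card_inj_on_le)
    show "finite (join_compatible A B C1 C2 f g)"
      by (rule finite_subset[of _ "bip_colourings (A \<times> B) (C1 \<union> C2)"])
         (use fin in \<open>auto simp: join_compatible_def finite_bip_colourings\<close>)
    show "inj_on ext (bip_colourings ?E C2)"
    proof (rule inj_onI)
      fix l l' assume l: "l \<in> bip_colourings ?E C2" "l' \<in> bip_colourings ?E C2" "ext l = ext l'"
      show "l = l'"
      proof (rule PiE_ext)
        show "l \<in> ?E \<rightarrow>\<^sub>E C2" "l' \<in> ?E \<rightarrow>\<^sub>E C2" using l by (simp_all only: bip_colourings_def mem_Collect_eq)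
        show "l e = l' e" if "e \<in> ?E" for e using fun_cong[OF l(3), of e] that unfolding ext_def by simp
      qed
    qed
    show "ext ` bip_colourings ?E C2 \<subseteq> join_compatible A B C1 C2 f g"
    proof
      fix k assume "k \<in> ext ` bip_colourings ?E C2"
      then obtain l where l: "l \<in> bip_colourings ?E C2" "k = ext l" by blast
      have k1: "k (x, y) = l (x, y)" if "x \<in> A" "y \<in> B" "?mf x \<noteq> ?mg y" for x y
        unfolding l(2) ext_apply[OF that(1,2)] by (rule if_P) (use inE[OF that(1,2)] that in blast)
      have k2: "k (x, y) = ?mf x" if "x \<in> A" "y \<in> B" "?mf x = ?mg y" for x y
        unfolding l(2) ext_apply[OF that(1,2)] by (rule if_not_P) (use inE[OF that(1,2)] that in blast)
      have lC: "l (x, y) \<in> C2" if "x \<in> A" "y \<in> B" "?mf x \<noteq> ?mg y" for x y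
        using inE[OF that(1,2)] that l(1) unfolding bip_colourings_def by blast
      have mC: "?mf x \<in> C1" if "x \<in> A" for x using bij_betwE[OF bf] that by blast
      have iff: "k (x, y) \<in> C1 \<longleftrightarrow> ?mf x = ?mg y" if "x \<in> A" "y \<in> B" for x y
        using k1[OF that] k2[OF that] lC[OF that] mC[OF that(1)] C by force
      have neq: "y = y'" if "x \<in> A" "y \<in> B" "y' \<in> B" "k (x, y) = k (x, y')" for x y y'
      proof (cases "?mf x = ?mg y")
        case True
        hence "?mg y = ?mg y'" using iff that by metis
        thus ?thesis using inj_onD[OF bij_betw_imp_inj_on[OF bg]] that by blast
      next
        case False
        hence F': "?mf x \<noteq> ?mg y'" using iff that by metis
        have "l (x, y) = l (x, y')" using k1 False F' that by metis
        thus ?thesis using bip_colourings_neq[OF l(1), of "(x, y)" "(x, y')"] inE that False F' by simp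
      qed
      have neq': "x = x'" if "x \<in> A" "x' \<in> A" "y \<in> B" "k (x, y) = k (x', y)" for x x' y
      proof (cases "?mf x = ?mg y")
        case True
        hence "?mf x = ?mf x'" using iff that by metis
        thus ?thesis using inj_onD[OF bij_betw_imp_inj_on[OF bf]] that by blast
      next
        case False
        hence F': "?mf x' \<noteq> ?mg y" using iff that by metis
        have "l (x, y) = l (x', y)" using k1 False F' that by metis
        thus ?thesis using bip_colourings_neq[OF l(1), of "(x, y)" "(x', y)"] inE that False F' by simp
      qed
      have "k \<in> A \<times> B \<rightarrow>\<^sub>E C1 \<union> C2"
      proof (rule PiE_I)
        fix e assume "e \<in> A \<times> B"
        then obtain x y where e: "e = (x, y)" "x \<in> A" "y \<in> B" by blast
        show "k e \<in> C1 \<union> C2"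
          using k1[OF e(2,3)] k2[OF e(2,3)] lC[OF e(2,3)] mC[OF e(2)] e(1) by (cases "?mf x = ?mg y") auto
      qed (use l in \<open>auto simp: ext_def\<close>)
      moreover have "e = e'" if "e \<in> A \<times> B" "e' \<in> A \<times> B" "fst e = fst e' \<or> snd e = snd e'" "k e = k e'" for e e'
        using that neq neq' by (elim SigmaE) auto
      ultimately have "k \<in> bip_colourings (A \<times> B) (C1 \<union> C2)" unfolding bip_colourings_def by blast
      moreover have "f {x, x'} \<noteq> k (x, y)" if "x \<in> A" "y \<in> B" "k (x, y) \<in> C1" "x' \<in> A - {x}" for x y x'
      proof -
        have "k (x, y) = ?mf x" using iff k2 that by metis
        thus ?thesis using missing_colour_neq[OF fin(1,3) _ f, of x x'] card that by auto
      qed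
      moreover have "g {y, y'} \<noteq> k (x, y)" if "x \<in> A" "y \<in> B" "k (x, y) \<in> C1" "y' \<in> B - {y}" for x y y'
      proof -
        have "k (x, y) = ?mg y" using iff k2 that by metis
        thus ?thesis using missing_colour_neq[OF fin(2,3) _ g, of y y'] card that by auto
      qed
      ultimately show "k \<in> join_compatible A B C1 C2 f g"
        unfolding join_compatible_def by blast
    qed
  qed
  finally show ?thesis by simp
qed

text \<open>
  The leading term is half of \<open>n\<^sup>2 * log 2 n\<close>, as there are about \<open>n\<^sup>2 / 2\<close> edges. The coefficient of
  the error term is three times \<open>real t + 8\<close>, where \<open>real t + 6\<close> is the corresponding coefficient of
  \<open>bip_exponent\<close>; this makes the recursion below close.
\<close>

definition complete_exponent :: "nat \<Rightarrow> nat \<Rightarrow> real" where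
  "complete_exponent t n = (1 - 1 / 2 ^ t) / 2 * (real n)\<^sup>2 * log 2 (real n) - 3 * (real t + 8) * (real n)\<^sup>2"

text \<open>
  Passing from \<open>2 * m\<close> to \<open>m\<close> quarters \<open>n\<^sup>2\<close>, while there are only two halves, so half of the error term
  is set free. It pays for the error in the bipartite part, for \<open>log 2 (2 * m) = log 2 m + 1\<close>, and for the
  rounding of \<open>m\<close> up to \<open>m + 1\<close> when \<open>m\<close> is odd. For the rounding, \<open>6 * (m + 1)\<^sup>2 \<le> 11 * m\<^sup>2\<close> from \<open>m = 3\<close>
  onwards.
\<close>

lemma complete_exponent_recursion:
  assumes "2 \<le> m" "m' = m \<or> (m' = m + 1 \<and> 3 \<le> m)"
  shows "complete_exponent t (2 * m) \<le> 2 * complete_exponent t m' + bip_exponent t m"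
proof -
  define \<alpha> :: real where "\<alpha> = 1 - 1 / 2 ^ t"
  define w where "w = real t + 8"
  define L where "L = log 2 (real m)"
  have \<alpha>: "0 \<le> \<alpha>" "\<alpha> \<le> 1" by (simp_all add: \<alpha>_def)
  have w: "8 \<le> w" by (simp add: w_def)
  have L: "log 2 (real (2 * m)) = L + 1" using assms(1) by (simp add: L_def log_mult)
  have "(real m)\<^sup>2 * log 2 (real m) \<le> (real m')\<^sup>2 * log 2 (real m')"
    using assms by (intro mult_mono) auto
  hence "\<alpha> * ((real m)\<^sup>2 * log 2 (real m)) \<le> \<alpha> * ((real m')\<^sup>2 * log 2 (real m'))"
    using \<alpha>(1) by (rule mult_left_mono)
  moreover have "6 * (real m')\<^sup>2 \<le> 11 * (real m)\<^sup>2"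
  proof (cases "m' = m")
    case False
    hence m: "m' = m + 1" "3 \<le> m" using assms by auto
    have "12 * real m + 6 \<le> 5 * (real m)\<^sup>2"
    proof -
      have "5 * 3 * real m \<le> 5 * real m * real m" using m by (intro mult_right_mono) auto
      moreover have "3 \<le> real m" using m by simp
      ultimately show ?thesis unfolding power2_eq_square by linarith
    qed
    thus ?thesis using m by (simp add: power2_eq_square algebra_simps)
  qed auto
  hence "w * (6 * (real m')\<^sup>2) \<le> w * (11 * (real m)\<^sup>2)" using w by (intro mult_left_mono) auto
  moreover have "\<alpha> * (real m)\<^sup>2 \<le> 1 * (real m)\<^sup>2" using \<alpha> by (intro mult_right_mono) auto
  moreover have "complete_exponent t (2 * m) = 2 * (\<alpha> * ((real m)\<^sup>2 * L)) + 2 * (\<alpha> * (real m)\<^sup>2) - 12 * (w * (real m)\<^sup>2)"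
    unfolding complete_exponent_def L \<alpha>_def[symmetric] w_def[symmetric]
    by (simp add: algebra_simps power2_eq_square)
  moreover have "2 * complete_exponent t m' = \<alpha> * ((real m')\<^sup>2 * log 2 (real m')) - 6 * (w * (real m')\<^sup>2)"
    unfolding complete_exponent_def \<alpha>_def[symmetric] w_def[symmetric] by (simp add: algebra_simps)
  moreover have "bip_exponent t m = \<alpha> * ((real m)\<^sup>2 * L) - (w * (real m)\<^sup>2) + 2 * (real m)\<^sup>2"
    unfolding bip_exponent_def \<alpha>_def[symmetric] w_def L_def by (simp add: algebra_simps)
  ultimately show ?thesis unfolding L_def by linarith
qed

text \<open>
  The statement quantifies over all vertex sets and palettes of the given sizes, because the
  induction applies it to the parts of \<open>V\<close> and \<open>C\<close>. Halves of odd size are first enlarged by one vertex,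
  which can be deleted again without reducing the number of colourings.
\<close>

lemma complete_colourings_lower_bound_even:
  fixes V C :: "nat set"
  assumes "1 \<le> t" "even n" "2 \<le> n" "finite V" "card V = n" "finite C" "card C = n - 1"
  shows "2 powr complete_exponent t n \<le> card (complete_colourings V C)"
  using assms(2-)
proof (induction n arbitrary: V C rule: less_induct)
  case (less n)
  then obtain m where n: "n = 2 * m" by blast
  show ?case
  proof (cases "m = 1")
    case True
    obtain x y where V: "V = {x, y}" "x \<noteq> y" using less.prems n True by (auto simp: card_2_iff)
    obtain k where k: "C = {k}" using less.prems n True by (auto simp: card_1_singleton_iff)
    have "(\<lambda>e\<in>pairs V. k) \<in> complete_colourings V C"
      unfolding complete_colourings_def using V k by auto
    moreover have "finite (complete_colourings V C)"
      using less.prems by (simp add: finite_complete_colourings)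
    ultimately have "1 \<le> card (complete_colourings V C)"
      by (metis One_nat_def Suc_leI card_gt_0_iff empty_iff)
    moreover have "complete_exponent t n \<le> 0"
      using True n by (simp add: complete_exponent_def) (rule order_trans[of _ 0], simp_all)
    hence "2 powr complete_exponent t n \<le> 1"
      using powr_mono[of "complete_exponent t n" 0 "2 :: real"] by simp
    ultimately show ?thesis by linarith
  next
    case False
    hence m: "2 \<le> m" using less.prems n by auto
    define m' where "m' = (if even m then m else m + 1)"
    have m': "even m'" "m' < n" "2 \<le> m'" "m' = m \<or> (m' = m + 1 \<and> 3 \<le> m)"
      using m n unfolding m'_def by (auto elim!: oddE)
    have cm: "m' - 1 \<le> n - 1" "n - 1 = (m' - 1) + (n - m')" using m' by auto
    obtain A B where AB: "V = A \<union> B" "A \<inter> B = {}" "card A = m" "card B = m"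
      using obtain_split[of V m m] less.prems n by (metis mult_2)
    obtain C1 C2 where C: "C = C1 \<union> C2" "C1 \<inter> C2 = {}" "card C1 = m' - 1" "card C2 = n - m'"
      using obtain_split[of C "m' - 1" "n - m'"] less.prems cm by metis
    have fin: "finite A" "finite B" "finite C1" "finite C2" using AB C less.prems by auto
    have half: "2 powr complete_exponent t m' \<le> card (complete_colourings D C1)"
      if D: "finite D" "card D = m" for D :: "nat set"
    proof (cases "even m")
      case True
      hence "m' = m" by (simp add: m'_def)
      thus ?thesis using less.IH[of m' D C1] m' D fin C by simp
    next
      case False
      hence eq: "m' = m + 1" by (simp add: m'_def)
      obtain z where z: "z \<notin> D" using ex_new_if_finite[OF infinite_UNIV_nat D(1)] by blast
      have "2 powr complete_exponent t m' \<le> card (complete_colourings (insert z D) C1)"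
        by (rule less.IH) (use m' D fin C z eq in auto)
      also have "\<dots> \<le> card (complete_colourings D C1)"
        using card_complete_colourings_delete_vertex[OF D(1) fin(3) _ z] D C eq by simp
      finally show ?thesis .
    qed
    \<comment> \<open>The ceiling turns the real lower bound into a natural number, as the joining lemma requires.\<close>
    define N where "N = nat \<lceil>2 powr bip_exponent t m\<rceil>"
    have "N \<le> card (join_compatible A B C1 C2 f g)"
      if "f \<in> complete_colourings A C1" "g \<in> complete_colourings B C1" for f g
    proof -
      have "2 powr bip_exponent t m \<le> card (join_compatible A B C1 C2 f g)"
      proof (cases "even m")
        case True
        hence "m' = m" by (simp add: m'_def)
        thus ?thesis
          by (intro join_compatible_even) (use fin AB C n m assms(1) in auto)
      next
        case False
        hence "m' = m + 1" by (simp add: m'_def)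
        thus ?thesis
          by (intro join_compatible_odd) (use fin AB C n m assms(1) False that in auto)
      qed
      thus ?thesis unfolding N_def by linarith
    qed
    from card_complete_colourings_join[OF AB(2) fin(1,2) C(2) fin(3,4) this]
    have "card (complete_colourings A C1) * card (complete_colourings B C1) * N
      \<le> card (complete_colourings V C)" using AB C by simp
    hence "real (card (complete_colourings A C1)) * real (card (complete_colourings B C1)) * real N
      \<le> real (card (complete_colourings V C))" by (metis of_nat_le_iff of_nat_mult)
    moreover have N: "2 powr bip_exponent t m \<le> real N" unfolding N_def by linarith
    have "2 powr complete_exponent t m' * 2 powr complete_exponent t m' * 2 powr bip_exponent t m
      \<le> real (card (complete_colourings A C1)) * real (card (complete_colourings B C1)) * real N"
      using mult_mono[OF mult_mono[OF half[OF fin(1) AB(3)] half[OF fin(2) AB(4)]] N]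
      by (simp only: mult_nonneg_nonneg powr_ge_zero of_nat_0_le_iff)
    moreover have "2 powr complete_exponent t m' * 2 powr complete_exponent t m' * 2 powr bip_exponent t m
      = 2 powr (2 * complete_exponent t m' + bip_exponent t m)" 
      by (simp only: powr_add mult_2 mult.assoc)
    moreover have "2 powr complete_exponent t n \<le> 2 powr (2 * complete_exponent t m' + bip_exponent t m)"
      unfolding n by (intro powr_mono complete_exponent_recursion m m') auto
    ultimately show ?thesis by linarith
  qed
qed

lemma complete_colourings_lower_bound_odd:
  fixes V C :: "nat set"
  assumes "1 \<le> t" "odd n" "finite V" "card V = n" "finite C" "card C = n"
  shows "2 powr complete_exponent t (n + 1) \<le> card (complete_colourings V C)"
proof -
  obtain z where z: "z \<notin> V" using ex_new_if_finite[OF infinite_UNIV_nat assms(3)] by blast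
  have "2 powr complete_exponent t (n + 1) \<le> card (complete_colourings (insert z V) C)"
    by (rule complete_colourings_lower_bound_even) (use assms z in \<open>auto elim!: oddE\<close>)
  also have "\<dots> \<le> card (complete_colourings V C)"
    using card_complete_colourings_delete_vertex[OF assms(3,5) _ z] assms by simp
  finally show ?thesis .
qed

section \<open>Idempotent colourings\<close>

text \<open>
  With the convention \<open>q {x, x} = x\<close>, these are the multiplication tables of the commutative idempotent
  quasigroups on \<open>{..<u}\<close>.
\<close>

definition idempotent_colourings :: "nat \<Rightarrow> (nat set \<Rightarrow> nat) set" where
  "idempotent_colourings u = {q \<in> complete_colourings {..<u} {..<u}.
     \<forall>x<u. \<forall>y<u. x \<noteq> y \<longrightarrow> q {x, y} \<noteq> x}"

lemma finite_idempotent_colourings: "finite (idempotent_colourings u)"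
  unfolding idempotent_colourings_def
  by (rule finite_subset[of _ "complete_colourings {..<u} {..<u}"])
     (auto simp: finite_complete_colourings)

text \<open>
  The missing colours form a permutation of \<open>{..<u}\<close>, and renaming the colours by its inverse makes
  the colouring idempotent. The factor \<open>fact u\<close> is negligible against the number of colourings.
\<close>

lemma card_complete_colourings_le_idempotent:
  assumes "odd u"
  shows "card (complete_colourings {..<u} {..<u}) \<le> card (idempotent_colourings u) * fact u"
proof -
  let ?U = "{..<u}"
  let ?S = "{\<sigma>. \<sigma> permutes ?U}"
  let ?h = "\<lambda>(q, \<sigma>). \<lambda>e\<in>pairs ?U. \<sigma> (q e)"
  have "complete_colourings ?U ?U \<subseteq> ?h ` (idempotent_colourings u \<times> ?S)"
  proof
    fix c assume c: "c \<in> complete_colourings ?U ?U"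
    let ?m = "missing_colour ?U ?U c"
    define \<sigma> where "\<sigma> = (\<lambda>x. if x < u then ?m x else x)"
    have bij: "bij_betw ?m ?U ?U" using missing_colour_bij[OF _ _ _ c] assms by simp
    have "bij_betw \<sigma> ?U ?U" using bij by (subst bij_betw_cong[of _ _ ?m]) (auto simp: \<sigma>_def)
    hence p: "\<sigma> permutes ?U" by (rule bij_imp_permutes) (simp add: \<sigma>_def)
    define q where "q = (\<lambda>e\<in>pairs ?U. inv \<sigma> (c e))"
    have q: "q {x, y} = inv \<sigma> (c {x, y})" if "x < u" "y < u" "x \<noteq> y" for x y
      using that by (simp add: q_def)
    have inj: "inv \<sigma> a = inv \<sigma> b \<longleftrightarrow> a = b" for a b
      using permutes_inj[OF permutes_inv[OF p]] by (simp add: inj_eq)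
    have "q \<in> pairs ?U \<rightarrow>\<^sub>E ?U"
      using complete_colouringsD(1)[OF c] permutes_in_image[OF permutes_inv[OF p]]
      by (auto simp: q_def PiE_iff)
    moreover have "y = z" if "x < u" "y < u" "z < u" "x \<noteq> y" "x \<noteq> z" "q {x, y} = q {x, z}" for x y z
      using complete_colouringsD(3)[OF c, of x y z] that by (simp add: q inj)
    ultimately have "q \<in> complete_colourings ?U ?U" unfolding complete_colourings_def by blast
    moreover have "q {x, y} \<noteq> x" if "x < u" "y < u" "x \<noteq> y" for x y
    proof
      assume "q {x, y} = x"
      hence "c {x, y} = \<sigma> x" using q[OF that] permutes_inverses(1)[OF p] by metis
      hence "c {x, y} = ?m x" using that by (simp add: \<sigma>_def)
      thus False using missing_colour_neq[OF _ _ _ c, of x y] that by simp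
    qed
    ultimately have "q \<in> idempotent_colourings u" by (simp add: idempotent_colourings_def)
    moreover have "c = ?h (q, \<sigma>)"
      using complete_colouringsD(1)[OF c] permutes_inverses(1)[OF p]
      by (auto simp: q_def fun_eq_iff PiE_iff extensional_def)
    ultimately show "c \<in> ?h ` (idempotent_colourings u \<times> ?S)" using p by blast
  qed
  hence "card (complete_colourings ?U ?U) \<le> card (?h ` (idempotent_colourings u \<times> ?S))"
    by (rule card_mono[rotated]) (simp add: finite_idempotent_colourings finite_permutations)
  also have "\<dots> \<le> card (idempotent_colourings u \<times> ?S)"
    by (rule card_image_le) (simp add: finite_idempotent_colourings finite_permutations)
  also have "\<dots> = card (idempotent_colourings u) * fact u"
    by (simp add: card_cartesian_product card_permutations)
  finally show ?thesis .
qed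

lemma idempotent_colouringsD:
  assumes "q \<in> idempotent_colourings u"
  shows "x < u \<Longrightarrow> y < u \<Longrightarrow> x \<noteq> y \<Longrightarrow> q {x, y} < u"
    and "x < u \<Longrightarrow> y < u \<Longrightarrow> x \<noteq> y \<Longrightarrow> q {x, y} \<noteq> x"
    and "x < u \<Longrightarrow> y < u \<Longrightarrow> x \<noteq> y \<Longrightarrow> q {x, y} \<noteq> y"
    and "x < u \<Longrightarrow> y < u \<Longrightarrow> z < u \<Longrightarrow> x \<noteq> y \<Longrightarrow> x \<noteq> z \<Longrightarrow> q {x, y} = q {x, z} \<Longrightarrow> y = z"
proof -
  have q: "q \<in> complete_colourings {..<u} {..<u}" using assms by (simp add: idempotent_colourings_def)
  have n: "q {x, y} \<noteq> x" if "x < u" "y < u" "x \<noteq> y" for x y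
    using assms that by (simp add: idempotent_colourings_def)
  show "q {x, y} < u" if "x < u" "y < u" "x \<noteq> y" using complete_colouringsD(2)[OF q] that by simp
  show "q {x, y} \<noteq> x" if "x < u" "y < u" "x \<noteq> y" using n that by simp
  show "q {x, y} \<noteq> y" if "x < u" "y < u" "x \<noteq> y" using n[of y x] that by (simp add: insert_commute)
  show "y = z" if "x < u" "y < u" "z < u" "x \<noteq> y" "x \<noteq> z" "q {x, y} = q {x, z}"
    using complete_colouringsD(3)[OF q, of x y z] that by simp
qed

lemma idempotent_colouring_solve:
  assumes q: "q \<in> idempotent_colourings u" and "a < u" "b < u" "a \<noteq> b"
  obtains y where "y < u" "y \<noteq> a" "q {a, y} = b"
proof -
  let ?U = "{..<u}"
  have qc: "q \<in> complete_colourings ?U ?U" using q by (simp add: idempotent_colourings_def)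
  have "missing_colour ?U ?U q a = a"
    by (rule missing_colour_eqI[OF _ _ _ qc]) (use idempotent_colouringsD(2)[OF q] assms in auto)
  thus ?thesis
    using colour_present[OF _ _ _ qc, of a b] assms that by auto
qed

section \<open>Bose triple systems\<close>

text \<open>
  The points \<open>(x, i)\<close> with \<open>x < u\<close> and level \<open>i < 3\<close>, numbered from \<open>0\<close> to \<open>3 * u - 1\<close>.
\<close>

definition point :: "nat \<Rightarrow> nat \<Rightarrow> nat" where
  "point x i = 3 * x + i"

definition next_level :: "nat \<Rightarrow> nat" where
  "next_level i = Suc i mod 3"

lemma next_level [simp]: "next_level i < 3" "i < 3 \<Longrightarrow> next_level i \<noteq> i" "i < 3 \<Longrightarrow> i \<noteq> next_level i"
  "i < 3 \<Longrightarrow> next_level (next_level i) \<noteq> i" "i < 3 \<Longrightarrow> i \<noteq> next_level (next_level i)" "i < 3 \<Longrightarrow> next_level (next_level (next_level i)) = i"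
  by (auto simp: next_level_def mod_Suc)

lemma next_level_inject: "i < 3 \<Longrightarrow> j < 3 \<Longrightarrow> next_level i = next_level j \<longleftrightarrow> i = j"
  by (auto simp: next_level_def mod_Suc)

lemma levels_adjacent: "i < 3 \<Longrightarrow> j < 3 \<Longrightarrow> i = j \<or> j = next_level i \<or> i = next_level j"
  by (auto simp: next_level_def mod_Suc)

lemma point_mod [simp]: "i < 3 \<Longrightarrow> point x i mod 3 = i"
  and point_inject [simp]: "i < 3 \<Longrightarrow> j < 3 \<Longrightarrow> point x i = point y j \<longleftrightarrow> x = y \<and> i = j"
  and point_less [simp]: "i < 3 \<Longrightarrow> point x i < 3 * u \<longleftrightarrow> x < u"
proof -
  show 1: "point x i mod 3 = i" if "i < 3" for x i using that by (simp add: point_def)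
  show "point x i = point y j \<longleftrightarrow> x = y \<and> i = j" if "i < 3" "j < 3"
    using that unfolding point_def by presburger
  show "point x i < 3 * u \<longleftrightarrow> x < u" if "i < 3" using that by (auto simp: point_def)
qed

lemma point_cases:
  assumes "p < 3 * u"
  obtains x i where "p = point x i" "x < u" "i < 3"
  using assms by (intro that[of "p div 3" "p mod 3"]) (auto simp: point_def)

definition vertical :: "nat \<Rightarrow> nat set" where
  "vertical x = {point x 0, point x 1, point x 2}"

definition mixed :: "(nat \<Rightarrow> nat set \<Rightarrow> nat) \<Rightarrow> nat \<Rightarrow> nat \<Rightarrow> nat \<Rightarrow> nat set" where
  "mixed Q i x y = {point x i, point y i, point (Q i {x, y}) (next_level i)}"

definition mixed_triples :: "nat \<Rightarrow> (nat \<Rightarrow> nat set \<Rightarrow> nat) \<Rightarrow> nat \<Rightarrow> nat set set" where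
  "mixed_triples u Q i = {mixed Q i x y | x y. x < u \<and> y < u \<and> x \<noteq> y}"

definition bose_triples :: "nat \<Rightarrow> (nat \<Rightarrow> nat set \<Rightarrow> nat) \<Rightarrow> nat set set" where
  "bose_triples u Q = vertical ` {..<u} \<union> (\<Union>i<3. mixed_triples u Q i)"

lemma point_in_vertical: "k < 3 \<Longrightarrow> point z k \<in> vertical x \<longleftrightarrow> z = x"
  by (auto simp: vertical_def)

lemma point_in_mixed: "i < 3 \<Longrightarrow> k < 3 \<Longrightarrow> point z k \<in> mixed Q i x y \<longleftrightarrow>
    k = i \<and> (z = x \<or> z = y) \<or> k = next_level i \<and> z = Q i {x, y}"
  by (auto simp: mixed_def)

lemma mixed_commute: "mixed Q i x y = mixed Q i y x"
  by (auto simp: mixed_def insert_commute)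

lemma bose_cases:
  assumes "T \<in> bose_triples u Q"
  obtains x where "x < u" "T = vertical x"
  | i x y where "i < 3" "x < u" "y < u" "x \<noteq> y" "T = mixed Q i x y"
  using assms by (auto simp: bose_triples_def mixed_triples_def)

lemma mixed_in_bose:
  "i < 3 \<Longrightarrow> x < u \<Longrightarrow> y < u \<Longrightarrow> x \<noteq> y \<Longrightarrow> mixed Q i x y \<in> bose_triples u Q"
  by (auto simp: bose_triples_def mixed_triples_def)

lemma ex1_implies_eq: "\<exists>!x. P x \<Longrightarrow> P a \<Longrightarrow> P b \<Longrightarrow> a = b"
  by blast

context
  fixes u :: nat and Q :: "nat \<Rightarrow> nat set \<Rightarrow> nat"
  assumes Q: "\<forall>i<3. Q i \<in> idempotent_colourings u"
begin

lemma level_idempotent: "i < 3 \<Longrightarrow> Q i \<in> idempotent_colourings u"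
  using Q by blast

lemma same_level_ex1:
  assumes "i < 3" "a < u" "b < u" "a \<noteq> b"
  shows "\<exists>!T. T \<in> bose_triples u Q \<and> point a i \<in> T \<and> point b i \<in> T"
proof (rule ex1I[of _ "mixed Q i a b"])
  show "mixed Q i a b \<in> bose_triples u Q \<and> point a i \<in> mixed Q i a b \<and> point b i \<in> mixed Q i a b"
    using assms by (auto simp: bose_triples_def mixed_triples_def point_in_mixed)
  fix T assume T: "T \<in> bose_triples u Q \<and> point a i \<in> T \<and> point b i \<in> T"
  hence "T \<in> bose_triples u Q" by simp
  thus "T = mixed Q i a b"
  proof (cases rule: bose_cases)
    case (1 x)
    thus ?thesis using T assms by (auto simp: point_in_vertical)
  next
    case (2 k x y)
    have "i = k" "(a = x \<or> a = y) \<and> (b = x \<or> b = y)"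
      using T assms 2 by (auto simp: point_in_mixed)
    thus ?thesis using 2 assms(4) mixed_commute by auto
  qed
qed

lemma adjacent_level_ex1:
  assumes "i < 3" "a < u" "b < u"
  shows "\<exists>!T. T \<in> bose_triples u Q \<and> point a i \<in> T \<and> point b (next_level i) \<in> T"
proof -
  have mix: "k = i \<and> b = Q i {x, y} \<and> (a = x \<or> a = y)"
    if "k < 3" "point a i \<in> mixed Q k x y" "point b (next_level i) \<in> mixed Q k x y" for k x y
    using that assms next_level_inject[of i k] by (auto simp: point_in_mixed)
  show ?thesis
  proof (cases "a = b")
    case True
    show ?thesis
    proof (rule ex1I[of _ "vertical a"])
      show "vertical a \<in> bose_triples u Q \<and> point a i \<in> vertical a \<and> point b (next_level i) \<in> vertical a"
        using assms True by (auto simp: bose_triples_def point_in_vertical)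
      fix T assume T: "T \<in> bose_triples u Q \<and> point a i \<in> T \<and> point b (next_level i) \<in> T"
      hence "T \<in> bose_triples u Q" by simp
      thus "T = vertical a"
      proof (cases rule: bose_cases)
        case (1 x)
        thus ?thesis using T assms by (auto simp: point_in_vertical)
      next
        case (2 k x y)
        have "b = Q i {x, y} \<and> (a = x \<or> a = y)" using mix[of k x y] T 2 by blast
        thus ?thesis using True idempotent_colouringsD(2,3)[OF level_idempotent[OF assms(1)], of x y] 2 by auto
      qed
    qed
  next
    case False
    obtain z where z: "z < u" "z \<noteq> a" "Q i {a, z} = b"
      using level_idempotent[OF assms(1)] assms(2,3) False by (rule idempotent_colouring_solve)
    show ?thesis
    proof (rule ex1I[of _ "mixed Q i a z"])
      show "mixed Q i a z \<in> bose_triples u Q \<and> point a i \<in> mixed Q i a z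
          \<and> point b (next_level i) \<in> mixed Q i a z"
        using assms z by (auto simp: bose_triples_def mixed_triples_def point_in_mixed)
      fix T assume T: "T \<in> bose_triples u Q \<and> point a i \<in> T \<and> point b (next_level i) \<in> T"
      hence "T \<in> bose_triples u Q" by simp
      thus "T = mixed Q i a z"
      proof (cases rule: bose_cases)
        case (1 x)
        thus ?thesis using T assms False by (auto simp: point_in_vertical)
      next
        case (2 k x y)
        have k: "k = i" "b = Q i {x, y}" "a = x \<or> a = y" using mix[of k x y] T 2 by blast+
        from k(3) show ?thesis
        proof
          assume ax: "a = x"
          have "y = z"
            by (rule idempotent_colouringsD(4)[OF level_idempotent[OF assms(1)], of a]) (use ax z k 2 in auto)
          thus ?thesis using 2 k ax by simp
        next
          assume ay: "a = y"
          have "x = z"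
            by (rule idempotent_colouringsD(4)[OF level_idempotent[OF assms(1)], of a])
               (use ay z k 2 in \<open>auto simp: insert_commute\<close>)
          thus ?thesis using 2 k ay mixed_commute by simp
        qed
      qed
    qed
  qed
qed

lemma bose_triple_subset_card:
  assumes "T \<in> bose_triples u Q"
  shows "T \<subseteq> {..<3 * u}" "card T = 3"
proof -
  have "T \<subseteq> {..<3 * u} \<and> card T = 3"
    using assms
  proof (cases rule: bose_cases)
    case (1 x)
    thus ?thesis by (auto simp: vertical_def)
  next
    case (2 i x y)
    hence "Q i {x, y} < u" using idempotent_colouringsD(1)[OF level_idempotent] by blast
    thus ?thesis using 2 by (auto simp: mixed_def)
  qed
  thus "T \<subseteq> {..<3 * u}" "card T = 3" by simp_all
qed

lemma bose_steiner: "steiner_triple_system (3 * u) ({..<3 * u}, bose_triples u Q)"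
  unfolding steiner_triple_system_def prod.case
proof (intro conjI ballI impI)
  show "T \<subseteq> {..<3 * u}" "card T = 3" if "T \<in> bose_triples u Q" for T
    using bose_triple_subset_card[OF that] .
  fix p p' assume "p \<in> {..<3 * u}" "p' \<in> {..<3 * u}" and neq: "p \<noteq> p'"
  then obtain a i b j where p: "p = point a i" "a < u" "i < 3" "p' = point b j" "b < u" "j < 3"
    using point_cases by (metis lessThan_iff)
  consider "i = j" "a \<noteq> b" | "j = next_level i" | "i = next_level j"
    using levels_adjacent[of i j] p neq by auto
  thus "\<exists>!T. T \<in> bose_triples u Q \<and> p \<in> T \<and> p' \<in> T"
  proof cases
    case 1
    thus ?thesis using same_level_ex1[of i a b] p by simp
  next
    case 2
    thus ?thesis using adjacent_level_ex1[of i a b] p by simp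
  next
    case 3
    thus ?thesis using adjacent_level_ex1[of j b a] p by (simp add: conj_commute)
  qed
qed simp_all

section \<open>Parallel classes and the chromatic index\<close>

lemma card_level_vertical:
  assumes "j < 3"
  shows "card {p \<in> vertical x. p mod 3 = j} = 1"
proof -
  have "p \<in> vertical x \<and> p mod 3 = j \<longleftrightarrow> p = point x j" for p
  proof -
    have "j = 0 \<or> j = 1 \<or> j = 2" using assms by arith
    thus ?thesis unfolding vertical_def point_def by (elim disjE) (simp_all, presburger+)
  qed
  hence "{p \<in> vertical x. p mod 3 = j} = {point x j}" by blast
  thus ?thesis by simp
qed

lemma card_level_mixed:
  assumes "i < 3" "x \<noteq> y"
  shows "card {p \<in> mixed Q i x y. p mod 3 = i} = 2"
    and "card {p \<in> mixed Q i x y. p mod 3 = next_level i} = 1"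
    and "card {p \<in> mixed Q i x y. p mod 3 = next_level (next_level i)} = 0"
proof -
  have level: "{p \<in> mixed Q i x y. p mod 3 = k} = (if i = k then {point x i, point y i} else {})
      \<union> (if next_level i = k then {point (Q i {x, y}) (next_level i)} else {})" for k
  proof -
    have "{p \<in> {a, b, c}. p mod 3 = k} = (if a mod 3 = k then {a} else {})
        \<union> (if b mod 3 = k then {b} else {}) \<union> (if c mod 3 = k then {c} else {})" for a b c :: nat
      by auto
    from this[of "point x i" "point y i" "point (Q i {x, y}) (next_level i)"]
    show ?thesis unfolding mixed_def using assms by auto
  qed
  have "{p \<in> mixed Q i x y. p mod 3 = i} = {point x i, point y i}"
    using assms by (simp add: level)
  thus "card {p \<in> mixed Q i x y. p mod 3 = i} = 2" using assms by simp
  have "{p \<in> mixed Q i x y. p mod 3 = next_level i} = {point (Q i {x, y}) (next_level i)}"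
    using assms by (simp add: level)
  thus "card {p \<in> mixed Q i x y. p mod 3 = next_level i} = 1" by simp
  have "{p \<in> mixed Q i x y. p mod 3 = next_level (next_level i)} = {}"
    using assms next_level(5)[of i] by (simp add: level next_level_inject)
  thus "card {p \<in> mixed Q i x y. p mod 3 = next_level (next_level i)} = 0" by (simp only: card.empty)
qed

lemma card_level_triple:
  assumes T: "T \<in> bose_triples u Q" and j: "j < 3"
  shows "card {p \<in> T. p mod 3 = next_level j} = of_bool (T \<in> vertical ` {..<u})
    + 2 * of_bool (T \<in> mixed_triples u Q (next_level j)) + of_bool (T \<in> mixed_triples u Q j)"
proof -
  have v: "card {p \<in> T. p mod 3 = k} = 1" if "T \<in> vertical ` {..<u}" "k < 3" for k
    using that card_level_vertical by auto
  have m: "card {p \<in> T. p mod 3 = k} = 2"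
      "card {p \<in> T. p mod 3 = next_level k} = 1"
      "card {p \<in> T. p mod 3 = next_level (next_level k)} = 0"
    if "T \<in> mixed_triples u Q k" "k < 3" for k
    using that card_level_mixed by (auto simp: mixed_triples_def)
  have vm: "\<not> (T \<in> vertical ` {..<u} \<and> T \<in> mixed_triples u Q k)" if "k < 3" for k
    using v[of k] m(1)[of k] that by auto
  have mm: "\<not> (T \<in> mixed_triples u Q k \<and> T \<in> mixed_triples u Q (next_level k))" if "k < 3" for k
    using m(2)[of k] m(1)[of "next_level k"] that by auto
  let ?k = "next_level (next_level j)"
  have l: "j = next_level ?k" using j by simp
  have "T \<in> vertical ` {..<u} \<or> T \<in> mixed_triples u Q j \<or> T \<in> mixed_triples u Q (next_level j)
      \<or> T \<in> mixed_triples u Q ?k"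
  proof -
    have "i = j \<or> i = next_level j \<or> i = ?k" if "i < 3" for i
      using that j by (auto simp: next_level_def mod_Suc)
    thus ?thesis using T by (auto simp: bose_triples_def)
  qed
  then consider "T \<in> vertical ` {..<u}" | "T \<in> mixed_triples u Q j"
    | "T \<in> mixed_triples u Q (next_level j)" | "T \<in> mixed_triples u Q ?k" by blast
  thus ?thesis
  proof cases
    case 1
    thus ?thesis using v[of "next_level j"] vm[of j] vm[of "next_level j"] j by simp
  next
    case 2
    thus ?thesis using m(2)[of j] vm[of j] mm[of j] j by simp
  next
    case 3
    thus ?thesis using m(1)[of "next_level j"] vm[of "next_level j"] mm[of j] j by simp
  next
    case 4
    have "card {p \<in> T. p mod 3 = next_level j} = 0" using m(3)[OF 4] j by simp
    moreover have "T \<notin> vertical ` {..<u}" using vm[of ?k] 4 by simp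
    moreover have "T \<notin> mixed_triples u Q (next_level j)" using mm[of "next_level j"] 4 by simp
    moreover have "T \<notin> mixed_triples u Q j" using mm[of ?k] 4 j by simp
    ultimately show ?thesis by simp
  qed
qed

text \<open>
  Let a parallel class consist of \<open>m\<close> vertical triples and, for each level \<open>i\<close>, of \<open>n i\<close> mixed triples
  with two points on that level. Counting its points on the level after \<open>i\<close> gives
  \<open>u = m + 2 * n (i + 1) + n i\<close>. These three equations force \<open>n 0 = n 1 = n 2\<close>, whence \<open>m\<close> is congruent to
  \<open>u\<close> modulo \<open>3\<close>.
\<close>

lemma parallel_class_two_verticals:
  assumes C: "C \<subseteq> bose_triples u Q" "disjoint C" and full: "card C = u" and u: "u mod 3 = 2"
  shows "2 \<le> card (C \<inter> vertical ` {..<u})"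
proof -
  have finT: "finite T" "T \<subseteq> {..<3 * u}" "card T = 3" if "T \<in> C" for T
    using bose_triple_subset_card[of T] that C by (auto intro: finite_subset)
  have finC: "finite C" using full u by (metis card.infinite mod_0 zero_neq_numeral)
  have "card (\<Union>C) = (\<Sum>T\<in>C. card T)"
    by (rule card_Union_disjoint) (use C finT in auto)
  also have "\<dots> = 3 * u" using finT full by simp
  finally have "\<Union>C = {..<3 * u}" using finT by (intro card_subset_eq) auto
  let ?m = "card (C \<inter> vertical ` {..<u})"
  let ?n = "\<lambda>i. card (C \<inter> mixed_triples u Q i)"
  have level: "u = ?m + 2 * ?n (next_level j) + ?n j" if j: "j < 3" for j
  proof -
    have "{p \<in> {..<3 * u}. p mod 3 = next_level j} = (\<lambda>x. point x (next_level j)) ` {..<u}"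
    proof (intro equalityI subsetI)
      fix p assume p: "p \<in> {p \<in> {..<3 * u}. p mod 3 = next_level j}"
      then obtain x i where "p = point x i" "x < u" "i < 3" using point_cases by blast
      thus "p \<in> (\<lambda>x. point x (next_level j)) ` {..<u}" using p by auto
    qed auto
    hence "u = card {p \<in> {..<3 * u}. p mod 3 = next_level j}"
      by (simp add: card_image inj_on_def)
    also have "{p \<in> {..<3 * u}. p mod 3 = next_level j} = (\<Union>T\<in>C. {p \<in> T. p mod 3 = next_level j})"
      using \<open>\<Union>C = {..<3 * u}\<close> by auto
    also have "card \<dots> = (\<Sum>T\<in>C. card {p \<in> T. p mod 3 = next_level j})"
    proof (rule card_UN_disjoint[OF finC])
      show "\<forall>T\<in>C. \<forall>T'\<in>C. T \<noteq> T' \<longrightarrow>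
          {p \<in> T. p mod 3 = next_level j} \<inter> {p \<in> T'. p mod 3 = next_level j} = {}"
        using C(2) unfolding disjoint_def by blast
    qed (use finT in auto)
    also have "\<dots> = (\<Sum>T\<in>C. of_bool (T \<in> vertical ` {..<u})
        + 2 * of_bool (T \<in> mixed_triples u Q (next_level j)) + of_bool (T \<in> mixed_triples u Q j))"
      by (rule sum.cong[OF refl card_level_triple[OF _ j]]) (use C in auto)
    also have "\<dots> = ?m + 2 * ?n (next_level j) + ?n j"
      using finC by (simp add: sum.distrib Int_def flip: sum_distrib_left)
    finally show ?thesis .
  qed
  have "u = ?m + 2 * ?n 1 + ?n 0" "u = ?m + 2 * ?n 2 + ?n 1" "u = ?m + 2 * ?n 0 + ?n 2"
    using level[of 0] level[of 1] level[of 2] by (simp_all add: next_level_def numeral_2_eq_2)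
  hence "u = ?m + 3 * ?n 0" by linarith
  thus ?thesis using u by presburger
qed

end

text \<open>
  Every pair of points lies in a triple, and a triple contains only three pairs.
\<close>

lemma steiner_card_blocks:
  assumes "steiner_triple_system v (V, B)"
  shows "v * (v - 1) \<le> 6 * card B"
proof -
  have S: "finite V" "card V = v" "\<And>T. T \<in> B \<Longrightarrow> T \<subseteq> V \<and> card T = 3"
    "\<And>x y. x \<in> V \<Longrightarrow> y \<in> V \<Longrightarrow> x \<noteq> y \<Longrightarrow> \<exists>!T. T \<in> B \<and> x \<in> T \<and> y \<in> T"
    using assms unfolding steiner_triple_system_def by auto
  have finB: "finite B" using S(1,3) by (auto intro: finite_subset[of B "Pow V"])
  have "pairs V \<subseteq> (\<Union>T\<in>B. pairs T)"
  proof
    fix e assume "e \<in> pairs V"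
    then obtain x y where e: "e = {x, y}" "x \<in> V" "y \<in> V" "x \<noteq> y" by (rule pairsE)
    then obtain T where "T \<in> B" "x \<in> T" "y \<in> T" using S(4)[of x y] by blast
    thus "e \<in> (\<Union>T\<in>B. pairs T)" using e by (intro UN_I[of T]) auto
  qed
  moreover have "finite T" if "T \<in> B" for T using S(1) S(3)[OF that] finite_subset by blast
  ultimately have "card (pairs V) \<le> card (\<Union>T\<in>B. pairs T)"
    using finB by (intro card_mono) (auto intro: finite_pairs)
  also have "\<dots> \<le> (\<Sum>T\<in>B. card (pairs T))" by (rule card_UN_le[OF finB])
  also have "\<dots> = (\<Sum>T\<in>B. 3)"
  proof (rule sum.cong[OF refl])
    fix T assume T: "T \<in> B"
    have "card (pairs T) = 3 choose 2"
      unfolding pairs_def using n_subsets[of T 2] S(1) S(3)[OF T] finite_subset by metis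
    thus "card (pairs T) = 3" by (simp add: choose_two)
  qed
  finally have "card (pairs V) \<le> 3 * card B" by simp
  moreover have "card (pairs V) = v choose 2" unfolding pairs_def using n_subsets[OF S(1)] S(2) by simp
  moreover have "v * (v - 1) = 2 * (v choose 2)" by (cases v) (auto simp: choose_two)
  ultimately show ?thesis by linarith
qed

lemma chromatic_index_partition:
  assumes "finite B"
  obtains P where "partition_on B P" "finite P" "card P = chromatic_index (V, B)"
    "\<And>C. C \<in> P \<Longrightarrow> C \<subseteq> B \<and> disjoint C"
proof -
  let ?R = "\<lambda>k P. partition_on B P \<and> finite P \<and> card P = k \<and>
    (\<forall>C\<in>P. partial_parallel_class (V, B) C)"
  let ?S = "(\<lambda>x. {x}) ` B"
  have "?R (card ?S) ?S"
    using assms partition_on_singletons[of B] by (auto simp: partial_parallel_class_def)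
  hence "\<exists>k P. ?R k P" by blast
  hence "\<exists>P. ?R (LEAST k. \<exists>P. ?R k P) P" by (rule LeastI_ex)
  thus ?thesis using that by (auto simp: chromatic_index_def partial_parallel_class_def)
qed

text \<open>
  As there are only \<open>u\<close> vertical triples, a partition of the triples into partial parallel classes
  contains at most \<open>(u - 1) / 2\<close> full ones. All other classes leave at least three points uncovered and
  so have at most \<open>u - 1\<close> triples. Then \<open>(3 * u + 1) / 2\<close> classes cannot hold all \<open>u * (3 * u - 1) / 2\<close>
  triples; they fall short by one.
\<close>

lemma bose_chromatic_index:
  assumes Q: "\<forall>i<3. Q i \<in> idempotent_colourings u" and u: "u mod 6 = 5"
  shows "3 * u + 3 \<le> 2 * chromatic_index ({..<3 * u}, bose_triples u Q)"
proof -
  let ?B = "bose_triples u Q" and ?W = "vertical ` {..<u}"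
  define k where "k = chromatic_index ({..<3 * u}, ?B)"
  note sub = bose_triple_subset_card[OF Q]
  have finB: "finite ?B" using sub(1) by (auto intro: finite_subset[of _ "Pow {..<3 * u}"])
  obtain P where P: "partition_on ?B P" "finite P" "card P = k"
      "\<And>C. C \<in> P \<Longrightarrow> C \<subseteq> ?B \<and> disjoint C"
    using chromatic_index_partition[OF finB, of "{..<3 * u}"] unfolding k_def by metis
  have finC: "finite C" if "C \<in> P" for C using P(4)[OF that] finB finite_subset by blast
  have size: "card C \<le> u" if C: "C \<in> P" for C
  proof -
    have "card (\<Union>C) = (\<Sum>T\<in>C. card T)"
      by (rule card_Union_disjoint) (use P(4)[OF C] sub(1) in \<open>auto intro: finite_subset\<close>)
    also have "\<dots> = 3 * card C" using P(4)[OF C] sub(2) by (simp add: subset_eq)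
    finally have "3 * card C = card (\<Union>C)" by simp
    also have "\<dots> \<le> card {..<3 * u}" using P(4)[OF C] sub(1) by (intro card_mono) auto
    finally show ?thesis by simp
  qed
  let ?F = "{C \<in> P. card C = u}"
  have "2 * card ?F = (\<Sum>C\<in>?F. 2)" by simp
  also have "\<dots> \<le> (\<Sum>C\<in>?F. card (C \<inter> ?W))"
  proof (rule sum_mono)
    fix C assume C: "C \<in> ?F"
    show "2 \<le> card (C \<inter> ?W)"
      by (rule parallel_class_two_verticals[OF Q]) (use C P(4)[of C] u in \<open>auto, presburger\<close>)
  qed
  also have "\<dots> = card (\<Union>C\<in>?F. C \<inter> ?W)"
  proof (rule card_UN_disjoint[symmetric])
    have "disjoint P" using P(1) by (rule partition_onD2)
    thus "\<forall>C\<in>?F. \<forall>C'\<in>?F. C \<noteq> C' \<longrightarrow> (C \<inter> ?W) \<inter> (C' \<inter> ?W) = {}"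
      unfolding disjoint_def by blast
  qed (use P(2) in auto)
  also have "\<dots> \<le> card ?W" by (rule card_mono) auto
  also have "\<dots> \<le> u" using card_image_le[of "{..<u}" vertical] by simp
  finally have F: "2 * card ?F \<le> u" .
  have "card ?B = (\<Sum>C\<in>P. card C)" using product_partition[OF P(1)] finC by simp
  also have "\<dots> \<le> (\<Sum>C\<in>P. (u - 1) + of_bool (card C = u))"
    by (rule sum_mono) (use size in fastforce)
  also have "\<dots> = k * (u - 1) + card ?F"
    using P by (simp add: sum.distrib Int_def)
  finally have B: "card ?B \<le> k * (u - 1) + card ?F" .
  have "3 * u * (3 * u - 1) \<le> 6 * card ?B"
    by (rule steiner_card_blocks[OF bose_steiner[OF Q]])
  hence low: "u * (3 * u - 1) \<le> 2 * card ?B" by (simp add: mult.assoc)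
  show ?thesis
  proof (rule ccontr)
    assume "\<not> ?thesis"
    hence "2 * k < 3 * u + 3" by (simp add: k_def)
    moreover have "odd u" using u by presburger
    then obtain w where w: "u = 2 * w + 1" by (rule oddE)
    ultimately have "k \<le> 3 * w + 2" "card ?F \<le> w" using F by linarith+
    hence "k * (u - 1) + card ?F \<le> (3 * w + 2) * (2 * w) + w" unfolding w
      by (intro add_mono mult_mono) auto
    hence "card ?B \<le> (3 * w + 2) * (2 * w) + w" by (rule order_trans[OF B])
    hence "2 * card ?B \<le> 2 * ((3 * w + 2) * (2 * w) + w)" by (rule mult_le_mono2)
    hence "u * (3 * u - 1) \<le> 2 * ((3 * w + 2) * (2 * w) + w)" by (rule order_trans[OF low])
    thus False unfolding w by (simp add: algebra_simps)
  qed
qed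

text \<open>
  The triple through two points on level \<open>i\<close> shows the value of the colouring on that level.
\<close>

lemma bose_inj:
  "inj_on (\<lambda>Q. ({..<3 * u}, bose_triples u Q)) ({..<3} \<rightarrow>\<^sub>E idempotent_colourings u)"
proof (rule inj_onI)
  fix Q Q' assume Q: "Q \<in> {..<3} \<rightarrow>\<^sub>E idempotent_colourings u"
    "Q' \<in> {..<3} \<rightarrow>\<^sub>E idempotent_colourings u"
    and "({..<3 * u}, bose_triples u Q) = ({..<3 * u}, bose_triples u Q')"
  hence eq: "bose_triples u Q = bose_triples u Q'" by simp
  have Q1: "\<forall>i<3. Q i \<in> idempotent_colourings u" "\<forall>i<3. Q' i \<in> idempotent_colourings u"
    using Q by auto
  show "Q = Q'"
  proof (rule PiE_ext[OF Q])
    fix i assume "i \<in> {..<3::nat}"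
    hence i: "i < 3" by simp
    have ext: "q \<in> pairs {..<u} \<rightarrow>\<^sub>E {..<u}" if "q \<in> idempotent_colourings u" for q
      using that by (simp add: idempotent_colourings_def complete_colouringsD(1))
    have mem: "Q i \<in> pairs {..<u} \<rightarrow>\<^sub>E {..<u}" "Q' i \<in> pairs {..<u} \<rightarrow>\<^sub>E {..<u}"
      using Q1 i ext by blast+
    show "Q i = Q' i"
    proof (rule PiE_ext[OF mem])
      fix e assume "e \<in> pairs {..<u}"
      then obtain x y where e: "e = {x, y}" "x < u" "y < u" "x \<noteq> y" by (elim pairsE) auto
      have "mixed Q' i x y \<in> bose_triples u Q" unfolding eq by (rule mixed_in_bose[OF i e(2-4)])
      moreover have "point x i \<in> mixed R i x y \<and> point y i \<in> mixed R i x y" for R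
        using i by (simp add: point_in_mixed)
      ultimately have "mixed Q i x y = mixed Q' i x y"
        using mixed_in_bose[OF i e(2-4), of Q] ex1_implies_eq[OF same_level_ex1[OF Q1(1) i e(2-4)]]
        by simp
      moreover have "point (Q i {x, y}) (next_level i) \<in> mixed Q i x y"
        using i by (simp add: point_in_mixed)
      ultimately have "point (Q i {x, y}) (next_level i) \<in> mixed Q' i x y" by simp
      thus "Q i e = Q' i e" using i e by (simp add: point_in_mixed)
    qed
  qed
qed

section \<open>Counting isomorphism classes\<close>

lemma card_bose_systems:
  assumes "u mod 6 = 5"
  shows "card (idempotent_colourings u) ^ 3
    \<le> card (sts_chromatic_index_ge (3 * u) ((real (3 * u) + 3) / 2))"
proof -
  let ?D = "{..<3::nat} \<rightarrow>\<^sub>E idempotent_colourings u"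
  have "(\<lambda>Q. ({..<3 * u}, bose_triples u Q)) ` ?D \<subseteq> sts_chromatic_index_ge (3 * u) ((real (3 * u) + 3) / 2)"
  proof (intro image_subsetI)
    fix Q assume "Q \<in> ?D"
    hence Q: "\<forall>i<3. Q i \<in> idempotent_colourings u" by auto
    have "real (3 * u + 3) \<le> real (2 * chromatic_index ({..<3 * u}, bose_triples u Q))"
      using bose_chromatic_index[OF Q assms] by (simp only: of_nat_le_iff)
    thus "({..<3 * u}, bose_triples u Q) \<in> sts_chromatic_index_ge (3 * u) ((real (3 * u) + 3) / 2)"
      using bose_steiner[OF Q] by (simp add: sts_chromatic_index_ge_def)
  qed
  from card_inj_on_le[OF bose_inj this finite_sts_chromatic_index_ge]
  show ?thesis by (simp add: card_PiE)
qed

text \<open>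
  The members of an isomorphism class are images of one of them under permutations of the points.
\<close>

lemma card_systems_le_classes:
  "card (sts_chromatic_index_ge v c) \<le> num_sts_classes v c * fact v"
proof -
  let ?S = "sts_chromatic_index_ge v c"
  let ?r = "isomorphism_rel ?S"
  have eqv: "equiv ?S ?r"
    by (rule equiv_isomorphism_rel[of _ v]) (simp add: sts_chromatic_index_ge_def)
  have finQ: "finite (?S // ?r)"
    by (rule finite_quotient[OF finite_sts_chromatic_index_ge]) (auto simp: isomorphism_rel_def)
  have cls: "card K \<le> fact v" if K: "K \<in> ?S // ?r" for K
  proof -
    obtain X where X: "X \<in> ?S" "K = ?r `` {X}" using K by (rule quotientE)
    obtain B where B: "X = ({..<v}, B)" using X(1) by (cases X) (auto simp: sts_chromatic_index_ge_def)
    let ?h = "\<lambda>f. ({..<v}, (\<lambda>T. f ` T) ` B)"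
    have TB: "T \<subseteq> {..<v}" if "T \<in> B" for T
      using X(1) that unfolding B sts_chromatic_index_ge_def steiner_triple_system_def by auto
    have "K \<subseteq> ?h ` {f. f permutes {..<v}}"
    proof
      fix Y assume "Y \<in> K"
      hence Y: "Y \<in> ?S" "isomorphic X Y" using X by (auto simp: isomorphism_rel_def)
      obtain B' where B': "Y = ({..<v}, B')" using Y(1) by (cases Y) (auto simp: sts_chromatic_index_ge_def)
      obtain f where f: "bij_betw f {..<v} {..<v}" "(\<lambda>T. f ` T) ` B = B'"
        using Y(2) by (auto simp: B B' isomorphic_def)
      define g where "g = (\<lambda>x. if x < v then f x else x)"
      have "bij_betw g {..<v} {..<v}" using f(1) by (subst bij_betw_cong[of _ _ f]) (auto simp: g_def)
      hence g: "g permutes {..<v}" by (rule bij_imp_permutes) (simp add: g_def)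
      have "g ` T = f ` T" if "T \<in> B" for T
        by (rule image_cong[OF refl]) (use TB[OF that] in \<open>auto simp: g_def\<close>)
      hence "(\<lambda>T. g ` T) ` B = B'" unfolding f(2)[symmetric] by (rule image_cong[OF refl])
      thus "Y \<in> ?h ` {f. f permutes {..<v}}" using g B' by blast
    qed
    hence "card K \<le> card (?h ` {f. f permutes {..<v}})"
      by (rule card_mono[rotated]) (simp add: finite_permutations)
    also have "\<dots> \<le> card {f. f permutes {..<v}}" by (rule card_image_le) (simp add: finite_permutations)
    finally show ?thesis by (simp add: card_permutations)
  qed
  have "card ?S = card (\<Union>(?S // ?r))" using Union_quotient[OF eqv] by simp
  also have "\<dots> \<le> (\<Sum>K\<in>?S // ?r. card K)" using card_UN_le[OF finQ, of id] by simp
  also have "\<dots> \<le> (\<Sum>K\<in>?S // ?r. fact v)" by (rule sum_mono[OF cls])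
  finally show ?thesis by (simp add: num_sts_classes_def)
qed

lemma num_sts_classes_factorial_bound:
  assumes "1 \<le> t" "u mod 6 = 5"
  shows "(2 powr complete_exponent t (u + 1)) ^ 3
    \<le> real (num_sts_classes (3 * u) ((real (3 * u) + 3) / 2)) * (fact (3 * u) * fact u ^ 3)"
proof -
  let ?U = "{..<u}"
  let ?N = "num_sts_classes (3 * u) ((real (3 * u) + 3) / 2)"
  have u: "odd u" using assms(2) by presburger
  have "2 powr complete_exponent t (u + 1) \<le> real (card (complete_colourings ?U ?U))"
    by (rule complete_colourings_lower_bound_odd) (use assms u in auto)
  also have "\<dots> \<le> real (card (idempotent_colourings u) * fact u)"
    using card_complete_colourings_le_idempotent[OF u] by (simp only: of_nat_le_iff)
  finally have "(2 powr complete_exponent t (u + 1)) ^ 3 \<le> real (card (idempotent_colourings u) * fact u) ^ 3"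
    by (intro power_mono) auto
  also have "\<dots> = real (card (idempotent_colourings u) ^ 3) * fact u ^ 3"
    by (simp add: power_mult_distrib)
  also have "\<dots> \<le> real (?N * fact (3 * u)) * fact u ^ 3"
  proof (rule mult_right_mono)
    have "card (idempotent_colourings u) ^ 3 \<le> ?N * fact (3 * u)"
      using card_bose_systems[OF assms(2)] card_systems_le_classes by (rule order_trans)
    thus "real (card (idempotent_colourings u) ^ 3) \<le> real (?N * fact (3 * u))"
      by (simp only: of_nat_le_iff)
  qed simp
  finally show ?thesis by (simp add: mult_ac)
qed

text \<open>
  With \<open>u = v / 3\<close>, three independent colourings contribute \<open>3 * u\<^sup>2 / 2 = v\<^sup>2 / 6\<close> to the coefficient of the
  logarithm. The factorials are at most \<open>v ^ (2 * v)\<close> together, and this cost as well as the change from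
  \<open>log 2 u\<close> to \<open>log 2 v\<close> is at most of order \<open>v\<^sup>2\<close>.
\<close>

lemma num_sts_classes_log_bound:
  assumes t: "1 \<le> t" and v: "v mod 18 = 15"
  defines "N \<equiv> num_sts_classes v ((real v + 3) / 2)"
  shows "0 < N"
    and "(1 - 1 / 2 ^ t) / 6 * (real v)\<^sup>2 * log 2 (real v) - (9 * real t + 75) * (real v)\<^sup>2
      \<le> log 2 (real N)"
proof -
  define u where "u = v div 3"
  have u: "v = 3 * u" "u mod 6 = 5" using v unfolding u_def by presburger+
  have u5: "5 \<le> u" using u(2) mod_less_eq_dividend[of u 6] by linarith
  define \<alpha> :: real where "\<alpha> = 1 - 1 / 2 ^ t"
  have \<alpha>: "0 \<le> \<alpha>" "\<alpha> \<le> 1" by (simp_all add: \<alpha>_def)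
  let ?g = "complete_exponent t (u + 1)"
  have main: "(2 powr ?g) ^ 3 \<le> real N * (fact (3 * u) * fact u ^ 3)"
    using num_sts_classes_factorial_bound[OF t u(2)] unfolding N_def u(1) .
  have "0 < (2 powr ?g) ^ 3" by simp
  hence "0 < real N * (fact (3 * u) * fact u ^ 3)" using main by (rule less_le_trans)
  thus N: "0 < N" by (cases "N = 0") auto
  have x: "real v = 3 * real u" "15 \<le> real v" using u(1) u5 by simp_all
  have fact_le: "(fact n :: real) \<le> real v ^ n" if "n \<le> v" for n
  proof -
    have "(fact n :: real) \<le> real n ^ n" using fact_le_power[of n, where 'a = real] by simp
    also have "\<dots> \<le> real v ^ n" using that by (intro power_mono) auto
    finally show ?thesis .
  qed
  have "(fact (3 * u) :: real) * fact u ^ 3 \<le> real v ^ (3 * u) * (real v ^ u) ^ 3"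
    by (intro mult_mono power_mono fact_le) (use u(1) in auto)
  also have "\<dots> = real v ^ (6 * u)"
    unfolding power_mult[symmetric] power_add[symmetric] by (simp add: algebra_simps)
  finally have "(2 powr ?g) ^ 3 \<le> real N * real v ^ (6 * u)"
    using main by (meson mult_left_mono of_nat_0_le_iff order_trans)
  hence "log 2 ((2 powr ?g) ^ 3) \<le> log 2 (real N * real v ^ (6 * u))"
    using N x by (subst log_le_cancel_iff) auto
  also have "log 2 (real N * real v ^ (6 * u)) = log 2 (real N) + 6 * real u * log 2 (real v)"
    using N x by (simp add: log_mult log_nat_power distrib_left)
  also have "log 2 ((2 powr ?g) ^ 3) = 3 * ?g" by (simp add: log_nat_power)
  finally have 1: "3 * ?g - 2 * real v * log 2 (real v) \<le> log 2 (real N)" by (simp add: x)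
  have lv: "0 \<le> log 2 (real v)" "log 2 (real v) \<le> real v"
  proof -
    show "0 \<le> log 2 (real v)" using x by simp
    show "log 2 (real v) \<le> real v" using log2_of_power_le[of v v] less_exp[of v] x by simp
  qed
  have 2: "2 * real v * log 2 (real v) \<le> 2 * (real v)\<^sup>2"
    using lv x unfolding power2_eq_square by (simp add: mult_left_mono)
  have u1: "real v / 3 \<le> real (u + 1)" "real (u + 1) \<le> real v" using x by auto
  have "log 2 (real v) - 2 \<le> log 2 (real (u + 1))"
  proof -
    have "log 2 (real v) - 2 = log 2 (real v / 4)"
      using x log_pow_cancel[of 2 2] by (simp add: log_divide)
    also have "\<dots> \<le> log 2 (real (u + 1))" using u1 x by (subst log_le_cancel_iff) auto
    finally show ?thesis .
  qed
  hence "(real v)\<^sup>2 / 9 * (log 2 (real v) - 2) \<le> (real v)\<^sup>2 / 9 * log 2 (real (u + 1))"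
    by (intro mult_left_mono) auto
  also have "\<dots> \<le> (real (u + 1))\<^sup>2 * log 2 (real (u + 1))"
  proof (rule mult_right_mono)
    have "(real v / 3)\<^sup>2 \<le> (real (u + 1))\<^sup>2" using u1 x by (intro power_mono) auto
    thus "(real v)\<^sup>2 / 9 \<le> (real (u + 1))\<^sup>2" by (simp add: power_divide)
  qed simp
  finally have "3 * \<alpha> / 2 * ((real v)\<^sup>2 / 9 * (log 2 (real v) - 2))
      \<le> 3 * \<alpha> / 2 * ((real (u + 1))\<^sup>2 * log 2 (real (u + 1)))"
    using \<alpha> by (intro mult_left_mono) auto
  moreover have "3 * \<alpha> / 2 * ((real v)\<^sup>2 / 9 * (log 2 (real v) - 2))
      = \<alpha> / 6 * (real v)\<^sup>2 * log 2 (real v) - \<alpha> * ((real v)\<^sup>2 / 3)"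
    by (simp add: field_simps)
  moreover have "\<alpha> * ((real v)\<^sup>2 / 3) \<le> 1 * ((real v)\<^sup>2 / 3)" using \<alpha> by (intro mult_right_mono) auto
  moreover have "(real (u + 1))\<^sup>2 \<le> (real v)\<^sup>2" using u1 by (intro power_mono) auto
  hence "9 * (real t + 8) * (real (u + 1))\<^sup>2 \<le> 9 * (real t + 8) * (real v)\<^sup>2"
    by (intro mult_left_mono) auto
  moreover have "3 * ?g = 3 * \<alpha> / 2 * ((real (u + 1))\<^sup>2 * log 2 (real (u + 1)))
      - 9 * (real t + 8) * (real (u + 1))\<^sup>2"
    unfolding complete_exponent_def \<alpha>_def[symmetric] by (simp add: algebra_simps)
  moreover have "(9 * real t + 75) * (real v)\<^sup>2 = 9 * (real t + 8) * (real v)\<^sup>2 + 3 * (real v)\<^sup>2"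
    by (simp add: algebra_simps)
  moreover have "0 \<le> (real v)\<^sup>2" by simp
  ultimately show "(1 - 1 / 2 ^ t) / 6 * (real v)\<^sup>2 * log 2 (real v) - (9 * real t + 75) * (real v)\<^sup>2
      \<le> log 2 (real N)"
    using 1 2 unfolding \<alpha>_def[symmetric] by linarith
qed

theorem theorem3:
  shows "\<exists>\<epsilon> :: nat \<Rightarrow> real.
    (\<epsilon> \<longlongrightarrow> 0) (inf at_top (principal {v. [v = 15] (mod 18)})) \<and>
    (\<forall>v. [v = 15] (mod 18) \<longrightarrow>
      real (num_sts_classes v ((real v + 3) / 2))
        \<ge> real v powr ((real v)\<^sup>2 * (1 / 6 + \<epsilon> v)))"
proof -
  define N where "N = (\<lambda>v. num_sts_classes v ((real v + 3) / 2))"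
  \<comment> \<open>The largest admissible exponent, cut off at \<open>0\<close>: only lower bounds on it are needed then.\<close>
  define \<epsilon> where "\<epsilon> = (\<lambda>v. min 0 (log 2 (real (N v)) / ((real v)\<^sup>2 * log 2 (real v)) - 1 / 6))"
  have cong: "v mod 18 = 15" "15 \<le> v" if "[v = 15] (mod 18)" for v :: nat
    using that mod_less_eq_dividend[of v 18] by (auto simp: cong_def)
  have "(\<epsilon> \<longlongrightarrow> 0) (inf at_top (principal {v. [v = 15] (mod 18)}))"
  proof (rule tendstoI)
    fix \<eta> :: real assume \<eta>: "0 < \<eta>"
    obtain t0 where t0: "(1 / 2 :: real) ^ t0 < \<eta>" using real_arch_pow_inv[OF \<eta>, of "1 / 2"] by auto
    define t where "t = Suc t0"
    have t: "1 \<le> t" "1 / 2 ^ t < \<eta>"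
      using t0 \<eta> power_decreasing[of t0 t "1 / 2 :: real"] by (simp_all add: t_def power_one_over)
    obtain k :: nat where k: "2 * (9 * real t + 75) / \<eta> < real k" using reals_Archimedean2 by blast
    have "eventually (\<lambda>v :: nat. 2 ^ k < v) at_top" by (rule eventually_gt_at_top)
    hence "eventually (\<lambda>v. [v = 15] (mod 18) \<longrightarrow> dist (\<epsilon> v) 0 < \<eta>) at_top"
    proof eventually_elim
      case (elim v)
      show ?case
      proof
        assume v: "[v = 15] (mod 18)"
        let ?L = "log 2 (real v)"
        have "real (2 ^ k) < real v" using elim by (simp only: of_nat_less_iff)
        hence "log 2 (2 ^ k) < ?L" using cong(2)[OF v] by (subst log_less_cancel_iff) auto
        hence L: "2 * (9 * real t + 75) / \<eta> < ?L" using k by simp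
        have pos: "0 < ?L" "0 < (real v)\<^sup>2 * ?L" using cong(2)[OF v] by simp_all
        have "(1 - 1 / 2 ^ t) / 6 * ((real v)\<^sup>2 * ?L) - (9 * real t + 75) / ?L * ((real v)\<^sup>2 * ?L)
            \<le> log 2 (real (N v))"
          using num_sts_classes_log_bound(2)[OF t(1) cong(1)[OF v]] pos(1) unfolding N_def by simp
        hence "((1 - 1 / 2 ^ t) / 6 - (9 * real t + 75) / ?L) * ((real v)\<^sup>2 * ?L) \<le> log 2 (real (N v))"
          by (simp only: left_diff_distrib)
        hence lower: "(1 - 1 / 2 ^ t) / 6 - (9 * real t + 75) / ?L \<le> log 2 (real (N v)) / ((real v)\<^sup>2 * ?L)"
          using pos(2) by (subst pos_le_divide_eq)
        have small: "(9 * real t + 75) / ?L < \<eta> / 2"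
          using L pos \<eta> by (simp add: field_simps)
        have "- \<eta> < c - 1 / 6" if "(1 - a) / 6 - b \<le> c" "b < \<eta> / 2" "a < \<eta>" for a b c :: real
          using that \<eta> by (simp add: field_simps)
        from this[OF lower small t(2)]
        have "- \<eta> < log 2 (real (N v)) / ((real v)\<^sup>2 * ?L) - 1 / 6" .
        hence "- \<eta> < \<epsilon> v" using \<eta> by (simp add: \<epsilon>_def)
        moreover have "\<epsilon> v \<le> 0" unfolding \<epsilon>_def by simp
        ultimately show "dist (\<epsilon> v) 0 < \<eta>" by (simp add: dist_real_def)
      qed
    qed
    thus "eventually (\<lambda>v. dist (\<epsilon> v) 0 < \<eta>) (inf at_top (principal {v. [v = 15] (mod 18)}))"
      by (simp add: eventually_inf_principal)
  qed
  moreover have "real v powr ((real v)\<^sup>2 * (1 / 6 + \<epsilon> v)) \<le> real (N v)" if v: "[v = 15] (mod 18)" for v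
  proof -
    let ?L = "log 2 (real v)"
    have v15: "15 \<le> real v" using cong(2)[OF v] by simp
    have pos: "0 < (real v)\<^sup>2 * ?L" using v15 by simp
    have N: "0 < real (N v)"
      using num_sts_classes_log_bound(1)[of 1 v] cong(1)[OF v] by (simp add: N_def)
    have "1 / 6 + \<epsilon> v \<le> log 2 (real (N v)) / ((real v)\<^sup>2 * ?L)" unfolding \<epsilon>_def by simp
    hence "(1 / 6 + \<epsilon> v) * ((real v)\<^sup>2 * ?L) \<le> log 2 (real (N v))"
      using pos by (subst (asm) pos_le_divide_eq)
    hence "?L * ((real v)\<^sup>2 * (1 / 6 + \<epsilon> v)) \<le> log 2 (real (N v))" by (simp only: mult_ac)
    hence "2 powr (?L * ((real v)\<^sup>2 * (1 / 6 + \<epsilon> v))) \<le> 2 powr log 2 (real (N v))"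
      by (rule powr_mono) simp
    also have "2 powr log 2 (real (N v)) = real (N v)" using N by simp
    also have "2 powr (?L * ((real v)\<^sup>2 * (1 / 6 + \<epsilon> v))) = real v powr ((real v)\<^sup>2 * (1 / 6 + \<epsilon> v))"
      using v15 by (simp add: powr_powr[symmetric])
    finally show ?thesis .
  qed
  ultimately show ?thesis unfolding N_def by blast
qed

end
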